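(* There is $\kappa>0$ such that for every (small) wavenumber $k_0\in(0,\kappa)$ and every unit vector $\boldsymbol a\in\mathbb S$ the following holds. For $\boldsymbol l\in\mathbb Z^2$ define $$\tau_{\boldsymbol l}=\frac{2\pi}{a}|\boldsymbol l|,\qquad \widehat x_{\boldsymbol l}=\begin{cases}\dfrac{\boldsymbol l}{|\boldsymbol l|},&\boldsymbol l\neq\boldsymbol 0,\\[2mm] \boldsymbol a,&\boldsymbol l=\boldsymbol 0.\end{cases}$$ Then for each $\boldsymbol l\in\mathbb Z^2$ the Fourier coefficient $\widehat\sigma_{\boldsymbol l}$ of the variance $\sigma^2$ of the random source $f=g+\sigma\dot W_x$ is determined by the covariance $\mathbf C[u^\infty(\widehat x_{\boldsymbol l};k_0+\tau_{\boldsymbol l}),u^\infty(\widehat x_{\boldsymbol l};k_0)]$; that is, if two admissible sources, given by $(g,\sigma)$ and $(g',\sigma')$, with far-field patterns $u^\infty$ and $u'^\infty$, satisfy $$\mathbf C[u^\infty(\widehat x_{\boldsymbol l};k_0+\tau_{\boldsymbol l}),u^\infty(\widehat x_{\boldsymbol l};k_0)]=\mathbf C[u'^\infty(\widehat x_{\boldsymbol l};k_0+\tau_{\boldsymbol l}),u'^\infty(\widehat x_{\boldsymbol l};k_0)],$$ then $\widehat\sigma_{\boldsymbol l}=\widehat{\sigma'}_{\boldsymbol l}$.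
   Context: Let $a>0$, $\Omega=(-a/2,a/2)\times(-a/2,a/2)\subset\mathbb R^2$ and $\mathbb S=\{x\in\mathbb R^2:|x|=1\}$. An admissible source is a random function $f=g+\sigma\dot W_x$, where $g$ and $\sigma\ge 0$ are deterministic real functions, independent of the wavenumber, compactly supported in $\Omega$, with $g,\sigma^2\in L^2(\Omega)$, and $\dot W_x$ is homogeneous white noise, the derivative of a one-dimensional two-parameter Brownian sheet $W(x)$. Integrals $\int_\Omega\psi(y)\,\mathrm dW_y$ of deterministic (possibly complex-valued) $\psi\in L^2(\Omega)$ are Wiener integrals against this white noise (whose correlation function is the delta function). $\mathbf E$ denotes expectation, and for complex random variables $\mathbf C[u,v]=\mathbf E\big[(u-\mathbf E[u])\overline{(v-\mathbf E[v])}\big]$. For wavenumber $k>0$, the radiating field $u$ solves $\Delta u+k^2u=-f$ in $\mathbb R^2$ with the Sommerfeld radiation condition $\lim_{r=|x|\to\infty}\sqrt r(\partial_ru-\mathrm iku)=0$ (in the mild sense), and its far-field pattern in direction $\widehat x\in\mathbb S$ is $$u^\infty(\widehat x;k)=\int_\Omega G_k^\infty(\widehat x,y)g(y)\,\mathrm dy+\int_\Omega G_k^\infty(\widehat x,y)\sigma(y)\,\mathrm dW_y,\qquad G_k^\infty(\widehat x,y)=\frac{\mathrm e^{\mathrm i\pi/4}}{\sqrt{8\pi k}}\mathrm e^{-\mathrm ik\widehat x\cdot y}.$$ The Fourier basis is $\phi_{\boldsymbol l}(x)=\mathrm e^{\mathrm i\frac{2\pi}{a}\boldsymbol l\cdot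 x}$, $\boldsymbol l\in\mathbb Z^2$. The symbol $\widehat\sigma_{\boldsymbol l}$ denotes the Fourier coefficient of $\sigma^2$ (not of $\sigma$): $\widehat\sigma_{\boldsymbol l}=\frac1{a^2}\int_\Omega\sigma^2(x)\overline{\phi_{\boldsymbol l}(x)}\,\mathrm dx$; similarly $\widehat{\sigma'}_{\boldsymbol l}$ is that of $(\sigma')^2$. $|\boldsymbol l|$ is the Euclidean norm. *)

theory Defs
  imports "HOL-Probability.Probability"
begin

definition square_integrable_on :: "(real \<times> real \<Rightarrow> real) \<Rightarrow> (real \<times> real) set \<Rightarrow> bool" where
  "square_integrable_on f S \<longleftrightarrow>
     f \<in> borel_measurable (lebesgue_on S) \<and> integrable (lebesgue_on S) (\<lambda>x. (f x)\<^sup>2)"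


text \<open>Degenerate (almost surely constant) variables count as Gaussian.\<close>

definition gaussian :: "'w measure \<Rightarrow> ('w \<Rightarrow> real) \<Rightarrow> bool" where
  "gaussian M X \<longleftrightarrow> X \<in> borel_measurable M \<and>
     (\<exists>\<mu>. (AE \<omega> in M. X \<omega> = \<mu>) \<or> (\<exists>s>0. distributed M lborel X (normal_density \<mu> s)))"

definition gaussian_process :: "'w measure \<Rightarrow> ('t \<Rightarrow> 'w \<Rightarrow> real) \<Rightarrow> bool" where
  "gaussian_process M X \<longleftrightarrow>
     (\<forall>T c. finite T \<longrightarrow> gaussian M (\<lambda>\<omega>. \<Sum>t\<in>T. c t * X t \<omega>))"

text \<open>The parameter set is all of \<open>\<real>\<^sup>2\<close>, because the domain below is centred at the origin.
  On \<open>[0,\<infinity>)\<^sup>2\<close> the covariance is the familiar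
  \<open>min s\<^sub>1 t\<^sub>1 * min s\<^sub>2 t\<^sub>2\<close>; the sheets on the four quadrants are independent. Continuity of
  paths is not required, since Wiener integrals do not depend on the choice of a modification.\<close>

definition two_sided_min :: "real \<Rightarrow> real \<Rightarrow> real" where
  "two_sided_min s t = (if 0 \<le> s * t then min \<bar>s\<bar> \<bar>t\<bar> else 0)"

definition brownian_sheet :: "'w measure \<Rightarrow> (real \<times> real \<Rightarrow> 'w \<Rightarrow> real) \<Rightarrow> bool" where
  "brownian_sheet M W \<longleftrightarrow> prob_space M \<and> gaussian_process M W \<and>
     (\<forall>t. (\<integral>\<omega>. W t \<omega> \<partial>M) = 0) \<and>
     (\<forall>s t. (\<integral>\<omega>. W s \<omega> * W t \<omega> \<partial>M) =
        two_sided_min (fst s) (fst t) * two_sided_min (snd s) (snd t))"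


text \<open>A step function is represented by a list of triples \<open>(c, p, q)\<close>, each standing for
  \<open>c\<close> times the indicator of the half-open rectangle with lower left corner \<open>p\<close> and
  upper right corner \<open>q\<close>. The corners must be ordered: for reversed corners the rectangle
  is empty, but the increment of the sheet need not vanish.\<close>

type_synonym steps = "(complex \<times> (real \<times> real) \<times> (real \<times> real)) list"

definition rectangle :: "real \<times> real \<Rightarrow> real \<times> real \<Rightarrow> (real \<times> real) set" where
  "rectangle p q = {fst p<..fst q} \<times> {snd p<..snd q}"

definition valid_steps :: "steps \<Rightarrow> bool" where
  "valid_steps s \<longleftrightarrow> (\<forall>(c, p, q) \<in> set s. fst p \<le> fst q \<and> snd p \<le> snd q)"

definition step_fun :: "steps \<Rightarrow> real \<times> real \<Rightarrow> complex" where
  "step_fun s x = (\<Sum>(c, p, q)\<leftarrow>s. c * indicator (rectangle p q) x)"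

definition increment ::
  "(real \<times> real \<Rightarrow> 'w \<Rightarrow> real) \<Rightarrow> real \<times> real \<Rightarrow> real \<times> real \<Rightarrow> 'w \<Rightarrow> real" where
  "increment W p q \<omega> = W q \<omega> - W (fst p, snd q) \<omega> - W (fst q, snd p) \<omega> + W p \<omega>"

definition step_integral :: "(real \<times> real \<Rightarrow> 'w \<Rightarrow> real) \<Rightarrow> steps \<Rightarrow> 'w \<Rightarrow> complex" where
  "step_integral W s \<omega> = (\<Sum>(c, p, q)\<leftarrow>s. c * complex_of_real (increment W p q \<omega>))"

text \<open>The Wiener integral is the \<open>L\<^sup>2\<close>-limit of integrals of step functions that converge
  to the integrand in \<open>L\<^sup>2(\<real>\<^sup>2)\<close>. It is determined only up to null sets, so
  \<open>wiener_integral\<close> picks some version.\<close>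

definition has_wiener_integral ::
  "'w measure \<Rightarrow> (real \<times> real \<Rightarrow> 'w \<Rightarrow> real) \<Rightarrow> (real \<times> real \<Rightarrow> complex) \<Rightarrow> ('w \<Rightarrow> complex) \<Rightarrow> bool"
where
  "has_wiener_integral M W \<psi> I \<longleftrightarrow>
     \<psi> \<in> borel_measurable lebesgue \<and> I \<in> borel_measurable M \<and>
     (\<exists>s. (\<forall>n. valid_steps (s n)) \<and>
        (\<lambda>n. \<integral>\<^sup>+y. ennreal ((cmod (step_fun (s n) y - \<psi> y))\<^sup>2) \<partial>lebesgue) \<longlonglongrightarrow> 0 \<and>
        (\<lambda>n. \<integral>\<^sup>+\<omega>. ennreal ((cmod (step_integral W (s n) \<omega> - I \<omega>))\<^sup>2) \<partial>M) \<longlonglongrightarrow> 0)"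

definition wiener_integral ::
  "'w measure \<Rightarrow> (real \<times> real \<Rightarrow> 'w \<Rightarrow> real) \<Rightarrow> (real \<times> real) set \<Rightarrow> (real \<times> real \<Rightarrow> complex)
    \<Rightarrow> 'w \<Rightarrow> complex" where
  "wiener_integral M W S \<psi> = (SOME I. has_wiener_integral M W (\<lambda>y. indicator S y * \<psi> y) I)"


definition square_domain :: "real \<Rightarrow> (real \<times> real) set" where
  "square_domain a = {-a/2<..<a/2} \<times> {-a/2<..<a/2}"

definition compactly_supported_in :: "(real \<times> real \<Rightarrow> real) \<Rightarrow> (real \<times> real) set \<Rightarrow> bool" where
  "compactly_supported_in f S \<longleftrightarrow>
     compact (closure {x. f x \<noteq> 0}) \<and> closure {x. f x \<noteq> 0} \<subseteq> S"

text \<open>The random source \<open>g + \<sigma> dW\<close> is represented by its coefficients \<open>g\<close>, \<open>\<sigma>\<close>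
  and the sheet \<open>W\<close> on the probability space \<open>M\<close>.\<close>

definition admissible_source ::
  "real \<Rightarrow> 'w measure \<Rightarrow> (real \<times> real \<Rightarrow> 'w \<Rightarrow> real) \<Rightarrow> (real \<times> real \<Rightarrow> real) \<Rightarrow> (real \<times> real \<Rightarrow> real)
    \<Rightarrow> bool" where
  "admissible_source a M W g \<sigma> \<longleftrightarrow> brownian_sheet M W \<and> (\<forall>x. 0 \<le> \<sigma> x) \<and>
     compactly_supported_in g (square_domain a) \<and> compactly_supported_in \<sigma> (square_domain a) \<and>
     square_integrable_on g (square_domain a) \<and> square_integrable_on (\<lambda>x. (\<sigma> x)\<^sup>2) (square_domain a)"

definition far_field_kernel :: "real \<Rightarrow> real \<times> real \<Rightarrow> real \<times> real \<Rightarrow> complex" where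
  "far_field_kernel k d y =
     exp (\<i> * of_real pi / 4) / of_real (sqrt (8 * pi * k)) * exp (- \<i> * of_real k * of_real (d \<bullet> y))"

definition far_field ::
  "real \<Rightarrow> 'w measure \<Rightarrow> (real \<times> real \<Rightarrow> 'w \<Rightarrow> real) \<Rightarrow> (real \<times> real \<Rightarrow> real) \<Rightarrow> (real \<times> real \<Rightarrow> real)
    \<Rightarrow> real \<times> real \<Rightarrow> real \<Rightarrow> 'w \<Rightarrow> complex" where
  "far_field a M W g \<sigma> d k \<omega> =
     (LINT y:square_domain a|lebesgue. far_field_kernel k d y * of_real (g y)) +
     wiener_integral M W (square_domain a) (\<lambda>y. far_field_kernel k d y * of_real (\<sigma> y)) \<omega>"

definition covariance :: "'w measure \<Rightarrow> ('w \<Rightarrow> complex) \<Rightarrow> ('w \<Rightarrow> complex) \<Rightarrow> complex" where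
  "covariance M u v =
     (\<integral>\<omega>. (u \<omega> - (\<integral>\<omega>'. u \<omega>' \<partial>M)) * cnj (v \<omega> - (\<integral>\<omega>'. v \<omega>' \<partial>M)) \<partial>M)"

definition lattice_point :: "int \<times> int \<Rightarrow> real \<times> real" where
  "lattice_point l = (of_int (fst l), of_int (snd l))"

definition fourier_basis :: "real \<Rightarrow> int \<times> int \<Rightarrow> real \<times> real \<Rightarrow> complex" where
  "fourier_basis a l x = exp (\<i> * of_real (2 * pi / a * (lattice_point l \<bullet> x)))"

definition fourier_coeff :: "real \<Rightarrow> (real \<times> real \<Rightarrow> real) \<Rightarrow> int \<times> int \<Rightarrow> complex" where
  "fourier_coeff a f l =
     1 / of_real (a\<^sup>2) * (LINT x:square_domain a|lebesgue. of_real (f x) * cnj (fourier_basis a l x))"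

definition wavenumber_shift :: "real \<Rightarrow> int \<times> int \<Rightarrow> real" where
  "wavenumber_shift a l = 2 * pi / a * norm (lattice_point l)"

definition observation_direction :: "real \<times> real \<Rightarrow> int \<times> int \<Rightarrow> real \<times> real" where
  "observation_direction d l =
     (if l = (0, 0) then d else lattice_point l /\<^sub>R norm (lattice_point l))"

end

theory Submission
  imports Defs
begin

text \<open>The deterministic part cancels from the covariance, which by the Wiener isometry equals the integral
  over \<open>\<Omega>\<close> of \<open>\<sigma>\<^sup>2\<close> times the product of one kernel with the conjugate of the other. In that
  product the wavenumber \<open>k\<^sub>0\<close> drops out of the phase, leaving
  \<open>exp (-\<i> \<tau> x \<bullet> y)\<close>, the conjugate of the Fourier basis function, because \<open>\<tau> x = (2\<pi>/a) l\<close>.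
  So the covariance is a nonzero multiple of the Fourier coefficient, for every \<open>k\<^sub>0 > 0\<close>.

  The Wiener integral exists because step functions are dense in \<open>L\<^sup>2\<close> and \<open>L\<^sup>2\<close> of the
  probability space is complete; the isometry passes to the limit from step functions, where it
  reduces to the covariance of increments of the sheet.\<close>

section \<open>Square integrable functions\<close>

text \<open>Membership in complex L2. Measurability of \<open>f\<close> is demanded separately,
  since that of the squared modulus says nothing about the phase.\<close>

definition sq_integrable :: "'a measure \<Rightarrow> ('a \<Rightarrow> complex) \<Rightarrow> bool" where
  "sq_integrable M f \<longleftrightarrow> f \<in> borel_measurable M \<and> integrable M (\<lambda>x. (cmod (f x))\<^sup>2)"

lemma sq_integrable_measurable [measurable_dest]: "sq_integrable M f \<Longrightarrow> f \<in> borel_measurable M"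
  by (simp add: sq_integrable_def)

lemma borel_measurable_cnj [measurable]: "cnj \<in> borel_measurable borel"
  by (intro borel_measurable_continuous_onI continuous_intros)

lemma sq_integrable_power2: "sq_integrable M f \<Longrightarrow> integrable M (\<lambda>x. (cmod (f x))\<^sup>2)"
  by (simp add: sq_integrable_def)

text \<open>This follows from \<open>2 * x * y \<le> x\<^sup>2 + y\<^sup>2\<close>. It stands in for
  the triangle inequality in L2 when only finiteness or smallness of squared norms matters.\<close>

lemma cmod_add_power2_le: "(cmod (z + w))\<^sup>2 \<le> 2 * (cmod z)\<^sup>2 + 2 * (cmod w)\<^sup>2"
proof -
  have "(cmod (z + w))\<^sup>2 \<le> (cmod z + cmod w)\<^sup>2"
    by (intro power_mono norm_triangle_ineq) simp
  then show ?thesis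
    using zero_le_power2[of "cmod z - cmod w"] by (simp add: power2_sum power2_diff)
qed

lemma sq_integrable_add:
  assumes "sq_integrable M f" "sq_integrable M g"
  shows "sq_integrable M (\<lambda>x. f x + g x)"
proof -
  note [measurable] = assms[THEN sq_integrable_measurable]
  have "integrable M (\<lambda>x. (cmod (f x + g x))\<^sup>2)"
  proof (rule Bochner_Integration.integrable_bound)
    show "integrable M (\<lambda>x. 2 * (cmod (f x))\<^sup>2 + 2 * (cmod (g x))\<^sup>2)"
      using assms[THEN sq_integrable_power2] by simp
  qed (auto intro!: AE_I2 order_trans[OF cmod_add_power2_le])
  then show ?thesis by (simp add: sq_integrable_def)
qed

lemma sq_integrable_cmult: "sq_integrable M f \<Longrightarrow> sq_integrable M (\<lambda>x. c * f x)"
  by (auto simp: sq_integrable_def norm_mult power_mult_distrib)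

lemma sq_integrable_diff:
  "sq_integrable M f \<Longrightarrow> sq_integrable M g \<Longrightarrow> sq_integrable M (\<lambda>x. f x - g x)"
  using sq_integrable_add[of M f "\<lambda>x. (-1) * g x"] sq_integrable_cmult[of M g "-1"] by simp

lemma sq_integrable_nn_integral_iff:
  "sq_integrable M f \<longleftrightarrow> f \<in> borel_measurable M \<and> (\<integral>\<^sup>+x. ennreal ((cmod (f x))\<^sup>2) \<partial>M) < \<infinity>"
  by (auto simp: sq_integrable_def integrable_iff_bounded)

lemma integrable_mult_cnj:
  assumes "sq_integrable M f" "sq_integrable M g"
  shows "integrable M (\<lambda>x. f x * cnj (g x))"
proof (rule Bochner_Integration.integrable_bound)
  note [measurable] = assms[THEN sq_integrable_measurable]
  show "integrable M (\<lambda>x. (cmod (f x))\<^sup>2 + (cmod (g x))\<^sup>2)"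
    using assms[THEN sq_integrable_power2] by simp
  show "(\<lambda>x. f x * cnj (g x)) \<in> borel_measurable M" by measurable
  have "cmod z * cmod w \<le> (cmod z)\<^sup>2 + (cmod w)\<^sup>2" for z w
  proof -
    have "0 \<le> cmod z * cmod w" by simp
    then show ?thesis
      using zero_le_power2[of "cmod z - cmod w"] unfolding power2_diff by linarith
  qed
  then show "AE x in M. cmod (f x * cnj (g x)) \<le> norm ((cmod (f x))\<^sup>2 + (cmod (g x))\<^sup>2)"
    by (auto simp: norm_mult)
qed

text \<open>The moduli are integrated first, so the classical argument with a nonnegative real
  quadratic in \<open>t\<close> applies and no phase has to be chosen.\<close>

lemma Cauchy_Schwarz_integral:
  assumes f: "sq_integrable M f" and g: "sq_integrable M g"
  shows "cmod (\<integral>x. f x * cnj (g x) \<partial>M) \<le>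
    sqrt (\<integral>x. (cmod (f x))\<^sup>2 \<partial>M) * sqrt (\<integral>x. (cmod (g x))\<^sup>2 \<partial>M)"
proof -
  define A where "A = (\<integral>x. (cmod (f x))\<^sup>2 \<partial>M)"
  define B where "B = (\<integral>x. (cmod (g x))\<^sup>2 \<partial>M)"
  define C where "C = (\<integral>x. cmod (f x) * cmod (g x) \<partial>M)"
  have int: "integrable M (\<lambda>x. cmod (f x) * cmod (g x))"
    using integrable_norm[OF integrable_mult_cnj[OF f g]] by (simp add: norm_mult)
  have AB: "A \<ge> 0" "B \<ge> 0" "C \<ge> 0"
    by (auto simp: A_def B_def C_def)
  have quad: "0 \<le> t\<^sup>2 * A - 2 * t * C + B" for t
  proof -
    have "0 \<le> (\<integral>x. (t * cmod (f x) - cmod (g x))\<^sup>2 \<partial>M)" by simp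
    also have "\<dots> = (\<integral>x. t\<^sup>2 * (cmod (f x))\<^sup>2 - 2 * t * (cmod (f x) * cmod (g x)) + (cmod (g x))\<^sup>2 \<partial>M)"
      by (intro Bochner_Integration.integral_cong) (auto simp: power2_diff power_mult_distrib)
    also have "\<dots> = t\<^sup>2 * A - 2 * t * C + B"
      using int f g by (simp add: A_def B_def C_def sq_integrable_power2)
    finally show ?thesis .
  qed
  have "C\<^sup>2 \<le> A * B"
  proof (cases "A = 0")
    case True
    have "C = 0"
    proof (rule ccontr)
      assume "C \<noteq> 0"
      \<comment> \<open>For \<open>A = 0\<close> the quadratic is the affine function
        \<open>B - 2 * t * C\<close>; this \<open>t\<close> gives it the value
        \<open>-1\<close>.\<close>
      with quad[of "(B + 1) / (2 * C)"] True show False by simp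
    qed
    with AB show ?thesis by simp
  next
    case False
    with AB have "A > 0" by simp
    \<comment> \<open>The minimum of the quadratic, attained at \<open>t = C / A\<close>, is
      \<open>B - C\<^sup>2 / A\<close>.\<close>
    with quad[of "C / A"] have "C\<^sup>2 / A \<le> B"
      by (simp add: power2_eq_square)
    with \<open>A > 0\<close> show ?thesis by (simp add: field_simps)
  qed
  then have "C \<le> sqrt A * sqrt B"
    by (simp add: real_le_rsqrt flip: real_sqrt_mult)
  moreover have "cmod (\<integral>x. f x * cnj (g x) \<partial>M) \<le> C"
    unfolding C_def using integral_norm_bound[of M "\<lambda>x. f x * cnj (g x)"] by (simp add: norm_mult)
  ultimately show ?thesis by (simp add: A_def B_def)
qed

text \<open>Joint continuity of the L2 inner product. It serves on the plane and on the probability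
  space alike, to carry the isometry from step functions to their limits.\<close>

lemma tendsto_integral_mult_cnj:
  assumes f: "sq_integrable M f" "\<And>n. sq_integrable M (F n)"
    and g: "sq_integrable M g" "\<And>n. sq_integrable M (G n)"
    and F: "(\<lambda>n. \<integral>\<^sup>+x. ennreal ((cmod (F n x - f x))\<^sup>2) \<partial>M) \<longlonglongrightarrow> 0"
    and G: "(\<lambda>n. \<integral>\<^sup>+x. ennreal ((cmod (G n x - g x))\<^sup>2) \<partial>M) \<longlonglongrightarrow> 0"
  shows "(\<lambda>n. \<integral>x. F n x * cnj (G n x) \<partial>M) \<longlonglongrightarrow> (\<integral>x. f x * cnj (g x) \<partial>M)"
proof -
  let ?N = "\<lambda>h. sqrt (\<integral>x. (cmod (h x))\<^sup>2 \<partial>M)"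
  have dist: "(\<lambda>n. ?N (\<lambda>x. H n x - h x)) \<longlonglongrightarrow> 0"
    if "sq_integrable M h" "\<And>n. sq_integrable M (H n)"
      "(\<lambda>n. \<integral>\<^sup>+x. ennreal ((cmod (H n x - h x))\<^sup>2) \<partial>M) \<longlonglongrightarrow> 0" for h H
  proof -
    have "(\<integral>\<^sup>+x. ennreal ((cmod (H n x - h x))\<^sup>2) \<partial>M) = ennreal (\<integral>x. (cmod (H n x - h x))\<^sup>2 \<partial>M)" for n
      using that by (intro nn_integral_eq_integral sq_integrable_power2 sq_integrable_diff) auto
    with that(3) have "(\<lambda>n. \<integral>x. (cmod (H n x - h x))\<^sup>2 \<partial>M) \<longlonglongrightarrow> 0"
      by (simp add: tendsto_ennreal_iff[of _ _ 0, simplified])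
    then show ?thesis using tendsto_real_sqrt by fastforce
  qed
  have "(\<lambda>n. (\<integral>x. F n x * cnj (G n x) \<partial>M) - (\<integral>x. f x * cnj (g x) \<partial>M)) \<longlonglongrightarrow> 0"
  proof (rule Lim_null_comparison)
    show "(\<lambda>n. ?N (\<lambda>x. F n x - f x) * ?N (\<lambda>x. G n x - g x) + ?N (\<lambda>x. F n x - f x) * ?N g
        + ?N f * ?N (\<lambda>x. G n x - g x)) \<longlonglongrightarrow> 0"
      using tendsto_mult[OF dist[OF f F] dist[OF g G]]
        tendsto_mult_right[OF dist[OF f F], of "?N g"] tendsto_mult_left[OF dist[OF g G], of "?N f"]
      by (auto intro: tendsto_add_zero)
    have "cmod ((\<integral>x. F n x * cnj (G n x) \<partial>M) - (\<integral>x. f x * cnj (g x) \<partial>M)) \<le>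
        ?N (\<lambda>x. F n x - f x) * ?N (\<lambda>x. G n x - g x) + ?N (\<lambda>x. F n x - f x) * ?N g
        + ?N f * ?N (\<lambda>x. G n x - g x)" for n
    proof -
      note df = sq_integrable_diff[OF f(2)[of n] f(1)]
      note dg = sq_integrable_diff[OF g(2)[of n] g(1)]
      have "(\<integral>x. F n x * cnj (G n x) \<partial>M) - (\<integral>x. f x * cnj (g x) \<partial>M) =
          (\<integral>x. F n x * cnj (G n x) - f x * cnj (g x) \<partial>M)"
        by (intro Bochner_Integration.integral_diff[symmetric] integrable_mult_cnj f g)
      \<comment> \<open>Expansion around the limits: in each summand one factor tends to 0 in L2,
        and the other is fixed or tends to 0 as well.\<close>
      also have "\<dots> = (\<integral>x. (F n x - f x) * cnj (G n x - g x) + (F n x - f x) * cnj (g x)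
          + f x * cnj (G n x - g x) \<partial>M)"
        by (intro Bochner_Integration.integral_cong) (auto simp: algebra_simps)
      also have "\<dots> = (\<integral>x. (F n x - f x) * cnj (G n x - g x) \<partial>M) + (\<integral>x. (F n x - f x) * cnj (g x) \<partial>M)
          + (\<integral>x. f x * cnj (G n x - g x) \<partial>M)"
        using integrable_mult_cnj[OF df dg] integrable_mult_cnj[OF df g(1)] integrable_mult_cnj[OF f(1) dg]
        by simp
      finally show ?thesis
        using Cauchy_Schwarz_integral[OF df dg] Cauchy_Schwarz_integral[OF df g(1)]
          Cauchy_Schwarz_integral[OF f(1) dg]
        by (smt (verit) norm_triangle_ineq)
    qed
    then show "\<forall>\<^sub>F n in sequentially. cmod ((\<integral>x. F n x * cnj (G n x) \<partial>M) - (\<integral>x. f x * cnj (g x) \<partial>M)) \<le>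
        ?N (\<lambda>x. F n x - f x) * ?N (\<lambda>x. G n x - g x) + ?N (\<lambda>x. F n x - f x) * ?N g
        + ?N f * ?N (\<lambda>x. G n x - g x)" by simp
  qed
  then show ?thesis by (simp add: LIM_zero_iff)
qed

text \<open>A single \<open>F n\<close> at finite distance from \<open>f\<close> is enough, because
  \<open>f\<close> is \<open>F n\<close> minus the difference \<open>F n - f\<close>. The bound 1 is
  an arbitrary finite one.\<close>

lemma sq_integrable_limit:
  assumes "\<And>n. sq_integrable M (F n)" and [measurable]: "f \<in> borel_measurable M"
    and lim: "(\<lambda>n. \<integral>\<^sup>+x. ennreal ((cmod (F n x - f x))\<^sup>2) \<partial>M) \<longlonglongrightarrow> 0"
  shows "sq_integrable M f"
proof -
  note [measurable] = assms(1)[THEN sq_integrable_measurable]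
  from order_tendstoD(2)[OF lim, of 1] obtain n
    where "(\<integral>\<^sup>+x. ennreal ((cmod (F n x - f x))\<^sup>2) \<partial>M) < 1"
    by (auto simp: eventually_sequentially)
  then have "sq_integrable M (\<lambda>x. F n x - f x)"
    by (auto simp: sq_integrable_nn_integral_iff intro: order_less_trans)
  from sq_integrable_diff[OF assms(1)[of n] this] show ?thesis by simp
qed

section \<open>Linear combinations indexed by lists of triples\<close>

lemma sq_integrable_zero: "sq_integrable M (\<lambda>x. 0)"
  by (simp add: sq_integrable_def)

text \<open>The family \<open>\<phi>\<close> stands for indicators of rectangles in
  \<open>step_fun\<close> and for increments of the sheet in \<open>step_integral\<close>, so both
  are covered at once.\<close>

lemma sq_integrable_sum_list:
  assumes "\<And>p q. sq_integrable M (\<phi> p q)"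
  shows "sq_integrable M (\<lambda>x. \<Sum>(c, p, q)\<leftarrow>s. c * \<phi> p q x)"
  using assms
  by (induction s) (auto simp: split_def intro!: sq_integrable_zero sq_integrable_add sq_integrable_cmult)

lemma integral_sum_list:
  fixes \<phi> :: "'b \<Rightarrow> 'c \<Rightarrow> 'a \<Rightarrow> complex"
  assumes "\<And>p q. integrable M (\<phi> p q)"
  shows "integrable M (\<lambda>x. \<Sum>(c, p, q)\<leftarrow>s. c * \<phi> p q x)"
    and "(\<integral>x. (\<Sum>(c, p, q)\<leftarrow>s. c * \<phi> p q x) \<partial>M) = (\<Sum>(c, p, q)\<leftarrow>s. c * (\<integral>x. \<phi> p q x \<partial>M))"
  using assms by (induction s) (auto simp: split_def)

text \<open>Sesquilinearity reduces an inner product of two combinations to the Gram matrix of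
  \<open>\<phi>\<close>. The isometry on step functions thereby becomes a comparison of two Gram
  matrices.\<close>

lemma integral_sum_list_mult_cnj:
  fixes \<phi> :: "'b \<Rightarrow> 'c \<Rightarrow> 'a \<Rightarrow> complex"
  assumes "\<And>p q. sq_integrable M (\<phi> p q)"
  shows "(\<integral>x. (\<Sum>(c, p, q)\<leftarrow>s. c * \<phi> p q x) * cnj (\<Sum>(c, p, q)\<leftarrow>t. c * \<phi> p q x) \<partial>M) =
    (\<Sum>(c, p, q)\<leftarrow>s. \<Sum>(c', p', q')\<leftarrow>t. c * cnj c' * (\<integral>x. \<phi> p q x * cnj (\<phi> p' q' x) \<partial>M))"
proof -
  \<comment> \<open>The second factor is expanded for one fixed entry of the first; the induction on
    \<open>s\<close> then uses this row by row.\<close>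
  have row: "(\<integral>x. \<phi> p q x * cnj (\<Sum>(c, p, q)\<leftarrow>t. c * \<phi> p q x) \<partial>M) =
      (\<Sum>(c', p', q')\<leftarrow>t. cnj c' * (\<integral>x. \<phi> p q x * cnj (\<phi> p' q' x) \<partial>M))" for p q
  proof (induction t)
    case (Cons e t)
    have "(\<integral>x. \<phi> p q x * cnj (\<Sum>(c, p, q)\<leftarrow>e # t. c * \<phi> p q x) \<partial>M) =
        (\<integral>x. cnj (fst e) * (\<phi> p q x * cnj (\<phi> (fst (snd e)) (snd (snd e)) x)) +
          \<phi> p q x * cnj (\<Sum>(c, p, q)\<leftarrow>t. c * \<phi> p q x) \<partial>M)"
      by (simp add: split_def algebra_simps)
    also have "\<dots> = cnj (fst e) * (\<integral>x. \<phi> p q x * cnj (\<phi> (fst (snd e)) (snd (snd e)) x) \<partial>M) +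
        (\<integral>x. \<phi> p q x * cnj (\<Sum>(c, p, q)\<leftarrow>t. c * \<phi> p q x) \<partial>M)"
      using integrable_mult_cnj[OF assms assms] integrable_mult_cnj[OF assms sq_integrable_sum_list[of M \<phi>, OF assms]]
      by (subst Bochner_Integration.integral_add) simp_all
    finally have eq: "(\<integral>x. \<phi> p q x * cnj (\<Sum>(c, p, q)\<leftarrow>e # t. c * \<phi> p q x) \<partial>M) = \<dots>" .
    show ?case unfolding eq Cons by (simp add: split_def)
  qed simp
  show ?thesis
  proof (induction s)
    case (Cons e s)
    let ?T = "\<lambda>x. \<Sum>(c, p, q)\<leftarrow>t. c * \<phi> p q x"
    have "(\<integral>x. (\<Sum>(c, p, q)\<leftarrow>e # s. c * \<phi> p q x) * cnj (?T x) \<partial>M) =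
        (\<integral>x. fst e * (\<phi> (fst (snd e)) (snd (snd e)) x * cnj (?T x)) +
          (\<Sum>(c, p, q)\<leftarrow>s. c * \<phi> p q x) * cnj (?T x) \<partial>M)"
      by (simp add: split_def algebra_simps)
    also have "\<dots> = fst e * (\<integral>x. \<phi> (fst (snd e)) (snd (snd e)) x * cnj (?T x) \<partial>M) +
        (\<integral>x. (\<Sum>(c, p, q)\<leftarrow>s. c * \<phi> p q x) * cnj (?T x) \<partial>M)"
      using integrable_mult_cnj[OF assms sq_integrable_sum_list[of M \<phi>, OF assms]]
        integrable_mult_cnj[OF sq_integrable_sum_list[of M \<phi>, OF assms] sq_integrable_sum_list[of M \<phi>, OF assms]]
      by (subst Bochner_Integration.integral_add) simp_all
    finally have eq: "(\<integral>x. (\<Sum>(c, p, q)\<leftarrow>e # s. c * \<phi> p q x) * cnj (?T x) \<partial>M) = \<dots>" .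
    show ?case
      unfolding eq row Cons by (simp add: split_def sum_list_const_mult mult.assoc)
  qed simp
qed

text \<open>The rate of convergence makes the whole sequence, not just a subsequence, converge almost
  everywhere: the sum of the \<open>2\<^sup>n |X\<^sub>n\<^sub>+\<^sub>1 - X\<^sub>n|\<^sup>2\<close> has finite integral.\<close>

lemma L2_complete_fast:
  fixes X :: "nat \<Rightarrow> 'a \<Rightarrow> complex"
  assumes X: "\<And>n. sq_integrable M (X n)"
    and fast: "\<And>n m. n \<le> m \<Longrightarrow> (\<integral>\<omega>. (cmod (X m \<omega> - X n \<omega>))\<^sup>2 \<partial>M) \<le> C * (1/4) ^ n"
  obtains Y where "Y \<in> borel_measurable M"
    "(\<lambda>n. \<integral>\<^sup>+\<omega>. ennreal ((cmod (X n \<omega> - Y \<omega>))\<^sup>2) \<partial>M) \<longlonglongrightarrow> 0"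
proof
  note [measurable] = sq_integrable_measurable[OF X]
  \<comment> \<open>\<open>lim\<close> has an unspecified value where the sequence diverges; by
    \<open>conv\<close> below this concerns only a null set.\<close>
  define Y where "Y \<omega> = lim (\<lambda>n. X n \<omega>)" for \<omega>
  show [measurable]: "Y \<in> borel_measurable M"
    unfolding Y_def[abs_def] by measurable
  define D where "D n \<omega> = 2 ^ n * (cmod (X (Suc n) \<omega> - X n \<omega>))\<^sup>2" for n \<omega>
  have nn_dist: "(\<integral>\<^sup>+\<omega>. ennreal ((cmod (X m \<omega> - X n \<omega>))\<^sup>2) \<partial>M) \<le> ennreal (C * (1/4) ^ n)"
    if "n \<le> m" for m n
    using fast[OF that] sq_integrable_power2[OF sq_integrable_diff[OF X X]]
    by (subst nn_integral_eq_integral) (auto intro: ennreal_leI)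
  \<comment> \<open>For \<open>n = m = 0\<close> the integral in \<open>fast\<close> vanishes and
    the right-hand side is \<open>C\<close>.\<close>
  have "C \<ge> 0"
    using fast[of 0 0] by simp
  have "AE \<omega> in M. (\<Sum>n. ennreal (D n \<omega>)) \<noteq> \<infinity>"
  proof (rule nn_integral_PInf_AE)
    show "(\<lambda>\<omega>. \<Sum>n. ennreal (D n \<omega>)) \<in> borel_measurable M"
      unfolding D_def by measurable
    have "(\<integral>\<^sup>+\<omega>. (\<Sum>n. ennreal (D n \<omega>)) \<partial>M) = (\<Sum>n. \<integral>\<^sup>+\<omega>. ennreal (D n \<omega>) \<partial>M)"
      by (rule nn_integral_suminf) (simp add: D_def)
    also have "\<dots> \<le> (\<Sum>n. ennreal (C * (1/2) ^ n))"
    proof (rule suminf_le)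
      show "(\<integral>\<^sup>+\<omega>. ennreal (D n \<omega>) \<partial>M) \<le> ennreal (C * (1/2) ^ n)" for n
      proof -
        have "(\<integral>\<^sup>+\<omega>. ennreal (D n \<omega>) \<partial>M) =
            ennreal (2 ^ n) * (\<integral>\<^sup>+\<omega>. ennreal ((cmod (X (Suc n) \<omega> - X n \<omega>))\<^sup>2) \<partial>M)"
          unfolding D_def by (subst nn_integral_cmult[symmetric]) (auto simp: ennreal_mult)
        also have "\<dots> \<le> ennreal (2 ^ n) * ennreal (C * (1/4) ^ n)"
          by (intro mult_left_mono nn_dist) auto
        also have "\<dots> = ennreal (C * (1/2) ^ n)"
        proof -
          have "(2 :: real) ^ n * (1/4) ^ n = (1/2) ^ n"
            by (simp flip: power_mult_distrib)
          then have "2 ^ n * (C * (1/4) ^ n) = C * (1/2) ^ n"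
            by (simp only: mult.left_commute[of _ C])
          then show ?thesis
            using \<open>C \<ge> 0\<close> by (subst ennreal_mult[symmetric]) simp_all
        qed
        finally show ?thesis .
      qed
    qed auto
    also have "\<dots> < \<top>"
      using \<open>C \<ge> 0\<close> by (subst less_top[symmetric], intro ennreal_suminf_neq_top summable_mult summable_geometric) auto
    finally show "(\<integral>\<^sup>+\<omega>. (\<Sum>n. ennreal (D n \<omega>)) \<partial>M) \<noteq> \<infinity>" by simp
  qed
  then have conv: "AE \<omega> in M. (\<lambda>n. X n \<omega>) \<longlonglongrightarrow> Y \<omega>"
  proof eventually_elim
    case (elim \<omega>)
    then have "summable (\<lambda>n. D n \<omega>)"
      by (intro summable_suminf_not_top) (auto simp: D_def)
    then have "summable (\<lambda>n. (1/2) ^ n + D n \<omega>)"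
      by (intro summable_add summable_geometric) auto
    \<comment> \<open>A difference \<open>b\<close> above \<open>(1/2) ^ n\<close> satisfies
      \<open>1 \<le> 2 ^ n * b\<close>, hence \<open>b \<le> 2 ^ n * b\<^sup>2\<close>, which is
      \<open>D n \<omega>\<close>. Either way a summable majorant results.\<close>
    moreover have "cmod (X (Suc n) \<omega> - X n \<omega>) \<le> (1/2) ^ n + D n \<omega>" for n
    proof (cases "cmod (X (Suc n) \<omega> - X n \<omega>) \<le> (1/2) ^ n")
      case True
      then show ?thesis by (simp add: D_def add_increasing2)
    next
      case False
      define b where "b = cmod (X (Suc n) \<omega> - X n \<omega>)"
      have "2 ^ n * (1/2) ^ n \<le> 2 ^ n * b"
        using False by (intro mult_left_mono) (auto simp: b_def)
      moreover have "2 ^ n * (1/2) ^ n = (1 :: real)"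
        by (simp flip: power_mult_distrib)
      ultimately have "1 * b \<le> 2 ^ n * b * b"
        by (intro mult_right_mono) (auto simp: b_def)
      then have "b \<le> D n \<omega>"
        by (simp only: D_def b_def power2_eq_square mult.assoc mult_1_left)
      then show ?thesis
        unfolding b_def by (rule add_increasing[rotated]) simp
    qed
    ultimately have "summable (\<lambda>n. X (Suc n) \<omega> - X n \<omega>)"
      by (rule summable_comparison_test'[where N = 0])
    then have "convergent (\<lambda>n. X 0 \<omega> + (\<Sum>k<n. X (Suc k) \<omega> - X k \<omega>))"
      by (intro convergent_add convergent_const) (simp add: summable_iff_convergent)
    then have "convergent (\<lambda>n. X n \<omega>)"
      by (simp add: sum_lessThan_telescope[of "\<lambda>n. X n \<omega>"])
    then show ?case by (simp add: Y_def convergent_LIMSEQ_iff)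
  qed
  \<comment> \<open>Fatou's lemma: \<open>m\<close> tends to infinity in the Cauchy estimate while
    \<open>n\<close> stays fixed.\<close>
  have bound: "(\<integral>\<^sup>+\<omega>. ennreal ((cmod (X n \<omega> - Y \<omega>))\<^sup>2) \<partial>M) \<le> ennreal (C * (1/4) ^ n)" for n
  proof -
    have "AE \<omega> in M. ennreal ((cmod (X n \<omega> - Y \<omega>))\<^sup>2) =
        liminf (\<lambda>m. ennreal ((cmod (X m \<omega> - X n \<omega>))\<^sup>2))"
      using conv
    proof eventually_elim
      case (elim \<omega>)
      then have "(\<lambda>m. ennreal ((cmod (X m \<omega> - X n \<omega>))\<^sup>2)) \<longlonglongrightarrow> ennreal ((cmod (Y \<omega> - X n \<omega>))\<^sup>2)"
        by (intro tendsto_ennrealI tendsto_intros)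
      from lim_imp_Liminf[OF sequentially_bot this] show ?case
        by (simp only: norm_minus_commute[of "Y \<omega>"])
    qed
    then have "(\<integral>\<^sup>+\<omega>. ennreal ((cmod (X n \<omega> - Y \<omega>))\<^sup>2) \<partial>M) =
        (\<integral>\<^sup>+\<omega>. liminf (\<lambda>m. ennreal ((cmod (X m \<omega> - X n \<omega>))\<^sup>2)) \<partial>M)"
      by (rule nn_integral_cong_AE)
    also have "\<dots> \<le> liminf (\<lambda>m. \<integral>\<^sup>+\<omega>. ennreal ((cmod (X m \<omega> - X n \<omega>))\<^sup>2) \<partial>M)"
      by (rule nn_integral_liminf) simp
    also have "\<dots> \<le> liminf (\<lambda>m. ennreal (C * (1/4) ^ n))"
      using nn_dist by (intro Liminf_mono) (auto simp: eventually_sequentially)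
    also have "\<dots> = ennreal (C * (1/4) ^ n)"
      by (simp add: Liminf_const)
    finally show ?thesis .
  qed
  have "(\<lambda>n. ennreal (C * (1/4) ^ n)) \<longlonglongrightarrow> ennreal (C * 0)"
    by (intro tendsto_ennrealI tendsto_intros LIMSEQ_power_zero) simp
  then show "(\<lambda>n. \<integral>\<^sup>+\<omega>. ennreal ((cmod (X n \<omega> - Y \<omega>))\<^sup>2) \<partial>M) \<longlonglongrightarrow> 0"
    by - (rule tendsto_sandwich[OF _ _ tendsto_const], auto intro!: always_eventually bound)
qed

section \<open>Density of step functions\<close>

lemma rectangle_in_borel [measurable]: "rectangle p q \<in> sets borel"
  by (auto simp: rectangle_def intro!: borel_Times)

lemma rectangle_finite_measure: "emeasure lborel (rectangle p q) < \<infinity>"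
proof -
  have "rectangle p q \<subseteq> cbox p q"
    by (cases p, cases q) (auto simp: rectangle_def cbox_Pair_eq)
  then have "bounded (rectangle p q)"
    using bounded_cbox bounded_subset by blast
  then show ?thesis by (rule emeasure_bounded_finite)
qed

lemma step_fun_Nil [simp]: "step_fun [] x = 0"
  by (simp add: step_fun_def)

lemma step_fun_Cons: "step_fun ((c, p, q) # s) x = c * indicator (rectangle p q) x + step_fun s x"
  by (simp add: step_fun_def)

lemma step_fun_append: "step_fun (s @ t) x = step_fun s x + step_fun t x"
  by (simp add: step_fun_def)

lemma step_fun_scale: "step_fun (map (\<lambda>(c, r). (b * c, r)) s) x = b * step_fun s x"
  by (induction s) (auto simp: step_fun_Cons distrib_left)

lemma valid_steps_simps [simp]:
  "valid_steps []"
  "valid_steps ((c, p, q) # s) \<longleftrightarrow> fst p \<le> fst q \<and> snd p \<le> snd q \<and> valid_steps s"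
  "valid_steps (s @ t) \<longleftrightarrow> valid_steps s \<and> valid_steps t"
  "valid_steps (map (\<lambda>(c, r). (b * c, r)) s) \<longleftrightarrow> valid_steps s"
  by (simp_all add: valid_steps_def ball_Un case_prod_unfold)

section \<open>Step functions in L2 and their closure\<close>

lemma sq_integrable_indicator:
  assumes "A \<in> sets M" "emeasure M A < \<infinity>"
  shows "sq_integrable M (indicator A)"
proof -
  have "integrable M (indicator A :: _ \<Rightarrow> real)"
    using assms by simp
  moreover have "(cmod (indicator A x))\<^sup>2 = indicator A x" for x
    by (simp add: indicator_def)
  ultimately show ?thesis
    using assms by (simp add: sq_integrable_def)
qed

lemma sq_integrable_step_fun: "sq_integrable lebesgue (step_fun s)"
  unfolding step_fun_def[abs_def] using rectangle_finite_measure
  by (intro sq_integrable_sum_list sq_integrable_indicator) auto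

text \<open>The L2 closure of the step functions. Closure under linear combinations and dominated
  limits will show that it is all of L2.\<close>

definition step_approximable :: "(real \<times> real \<Rightarrow> complex) \<Rightarrow> bool" where
  "step_approximable f \<longleftrightarrow> sq_integrable lebesgue f \<and>
     (\<forall>\<epsilon>>0. \<exists>s. valid_steps s \<and> (\<integral>x. (cmod (step_fun s x - f x))\<^sup>2 \<partial>lebesgue) < \<epsilon>)"

lemma integral_cmod_add_power2_le:
  assumes "sq_integrable M f" "sq_integrable M g"
  shows "(\<integral>x. (cmod (f x + g x))\<^sup>2 \<partial>M) \<le>
    2 * (\<integral>x. (cmod (f x))\<^sup>2 \<partial>M) + 2 * (\<integral>x. (cmod (g x))\<^sup>2 \<partial>M)"
proof -
  have "(\<integral>x. (cmod (f x + g x))\<^sup>2 \<partial>M) \<le> (\<integral>x. 2 * (cmod (f x))\<^sup>2 + 2 * (cmod (g x))\<^sup>2 \<partial>M)"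
    using assms sq_integrable_add[OF assms]
    by (intro integral_mono cmod_add_power2_le) (simp_all add: sq_integrable_power2)
  also have "\<dots> = 2 * (\<integral>x. (cmod (f x))\<^sup>2 \<partial>M) + 2 * (\<integral>x. (cmod (g x))\<^sup>2 \<partial>M)"
    using assms by (simp add: sq_integrable_power2)
  finally show ?thesis .
qed

lemma step_approximable_zero: "step_approximable (\<lambda>x. 0)"
  unfolding step_approximable_def
  by (auto intro!: sq_integrable_zero exI[of _ "[]"])

lemma step_approximable_rectangle:
  assumes "fst p \<le> fst q" "snd p \<le> snd q"
  shows "step_approximable (indicator (rectangle p q))"
proof -
  have "step_fun [(1, p, q)] = indicator (rectangle p q)"
    by (auto simp: step_fun_Cons)
  then show ?thesis
    using sq_integrable_step_fun[of "[(1, p, q)]"] assms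
    by (auto simp: step_approximable_def intro!: exI[of _ "[(1, p, q)]"])
qed

lemma step_approximable_add:
  assumes "step_approximable f" "step_approximable g"
  shows "step_approximable (\<lambda>x. f x + g x)"
  unfolding step_approximable_def
proof (intro conjI allI impI)
  show "sq_integrable lebesgue (\<lambda>x. f x + g x)"
    using assms by (auto simp: step_approximable_def intro: sq_integrable_add)
next
  fix \<epsilon> :: real assume "\<epsilon> > 0"
  \<comment> \<open>The factor 2 in \<open>integral_cmod_add_power2_le\<close> turns two errors of a
    quarter into two halves of \<epsilon>.\<close>
  then have "\<epsilon> / 4 > 0" by simp
  with assms obtain s t where s: "valid_steps s" "valid_steps t"
    and le: "(\<integral>x. (cmod (step_fun s x - f x))\<^sup>2 \<partial>lebesgue) < \<epsilon> / 4"
      "(\<integral>x. (cmod (step_fun t x - g x))\<^sup>2 \<partial>lebesgue) < \<epsilon> / 4"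
    unfolding step_approximable_def by meson
  have "(\<integral>x. (cmod (step_fun (s @ t) x - (f x + g x)))\<^sup>2 \<partial>lebesgue) =
      (\<integral>x. (cmod ((step_fun s x - f x) + (step_fun t x - g x)))\<^sup>2 \<partial>lebesgue)"
    by (simp add: step_fun_append algebra_simps)
  also have "\<dots> < \<epsilon>"
    using assms le integral_cmod_add_power2_le[of lebesgue "\<lambda>x. step_fun s x - f x" "\<lambda>x. step_fun t x - g x"]
    by (simp add: step_approximable_def sq_integrable_diff sq_integrable_step_fun)
  finally show "\<exists>u. valid_steps u \<and> (\<integral>x. (cmod (step_fun u x - (f x + g x)))\<^sup>2 \<partial>lebesgue) < \<epsilon>"
    using s by (intro exI[of _ "s @ t"]) simp
qed

lemma step_approximable_cmult:
  assumes "step_approximable f"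
  shows "step_approximable (\<lambda>x. c * f x)"
proof (cases "c = 0")
  case True
  then show ?thesis using step_approximable_zero by simp
next
  case False
  show ?thesis
    unfolding step_approximable_def
  proof (intro conjI allI impI)
    show "sq_integrable lebesgue (\<lambda>x. c * f x)"
      using assms by (auto simp: step_approximable_def intro: sq_integrable_cmult)
  next
    fix \<epsilon> :: real assume "\<epsilon> > 0"
    with False have "\<epsilon> / (cmod c)\<^sup>2 > 0" by simp
    with assms obtain s where s: "valid_steps s"
      "(\<integral>x. (cmod (step_fun s x - f x))\<^sup>2 \<partial>lebesgue) < \<epsilon> / (cmod c)\<^sup>2"
      unfolding step_approximable_def by meson
    let ?t = "map (\<lambda>(d, r). (c * d, r)) s"
    have "(\<integral>x. (cmod (step_fun ?t x - c * f x))\<^sup>2 \<partial>lebesgue) =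
        (\<integral>x. (cmod c)\<^sup>2 * (cmod (step_fun s x - f x))\<^sup>2 \<partial>lebesgue)"
      unfolding step_fun_scale by (simp flip: right_diff_distrib add: norm_mult power_mult_distrib)
    also have "\<dots> < \<epsilon>"
      using s False by (simp add: field_simps)
    finally show "\<exists>u. valid_steps u \<and> (\<integral>x. (cmod (step_fun u x - c * f x))\<^sup>2 \<partial>lebesgue) < \<epsilon>"
      using s by (intro exI[of _ ?t]) simp
  qed
qed

lemma step_approximable_diff:
  "step_approximable f \<Longrightarrow> step_approximable g \<Longrightarrow> step_approximable (\<lambda>x. f x - g x)"
  using step_approximable_add[of f "\<lambda>x. (-1) * g x"] step_approximable_cmult[of g "-1"] by simp

lemma step_approximable_sum:
  "(\<And>i. i \<in> I \<Longrightarrow> step_approximable (f i)) \<Longrightarrow> step_approximable (\<lambda>x. \<Sum>i\<in>I. f i x)"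
  by (induction I rule: infinite_finite_induct) (simp_all add: step_approximable_zero step_approximable_add)

text \<open>Permits replacing a Lebesgue measurable set by a Borel set that differs from it by a
  null set.\<close>

lemma step_approximable_cong_AE:
  assumes f: "step_approximable f" and [measurable]: "g \<in> borel_measurable lebesgue"
    and ae: "AE x in lebesgue. f x = g x"
  shows "step_approximable g"
proof -
  have sqf: "sq_integrable lebesgue f"
    using f by (simp add: step_approximable_def)
  note [measurable] = sq_integrable_measurable[OF this] sq_integrable_measurable[OF sq_integrable_step_fun]
  have "sq_integrable lebesgue g"
  proof -
    have "AE x in lebesgue. (cmod (f x))\<^sup>2 = (cmod (g x))\<^sup>2"
      using ae by eventually_elim simp
    then show ?thesis
      using sqf integrable_cong_AE[of "\<lambda>x. (cmod (f x))\<^sup>2" lebesgue "\<lambda>x. (cmod (g x))\<^sup>2"]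
      by (simp add: sq_integrable_def)
  qed
  moreover have "(\<integral>x. (cmod (step_fun s x - f x))\<^sup>2 \<partial>lebesgue) =
      (\<integral>x. (cmod (step_fun s x - g x))\<^sup>2 \<partial>lebesgue)" for s
    using ae by (intro integral_cong_AE) auto
  ultimately show ?thesis
    using f by (simp add: step_approximable_def)
qed

text \<open>Dominated convergence, applied to the squared distances, gives L2 convergence of
  \<open>F n\<close> to \<open>f\<close>; a step function close to one late \<open>F n\<close> is
  then close to \<open>f\<close>. The majorant is \<open>4 * (w x)\<^sup>2\<close> because both
  functions are bounded by \<open>w\<close>.\<close>

lemma step_approximable_dominated:
  fixes w :: "real \<times> real \<Rightarrow> real"
  assumes F: "\<And>n. step_approximable (F n)" and [measurable]: "f \<in> borel_measurable lebesgue"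
    and lim: "\<And>x. (\<lambda>n. F n x) \<longlonglongrightarrow> f x"
    and w: "integrable lebesgue (\<lambda>x. (w x)\<^sup>2)" "\<And>n x. cmod (F n x) \<le> w x"
  shows "step_approximable f"
proof -
  have fw: "cmod (f x) \<le> w x" for x
    using lim[of x] w(2)[of _ x] by (intro LIMSEQ_le_const2[OF tendsto_norm]) auto
  have sqF: "sq_integrable lebesgue (F n)" for n
    using F by (simp add: step_approximable_def)
  note [measurable] = sq_integrable_measurable[OF sqF]
  have sqf: "sq_integrable lebesgue f"
    unfolding sq_integrable_def
    by (intro conjI assms(2) Bochner_Integration.integrable_bound[OF w(1)] AE_I2)
       (use fw in \<open>auto intro!: power_mono\<close>)
  have "(\<lambda>n. \<integral>x. (cmod (F n x - f x))\<^sup>2 \<partial>lebesgue) \<longlonglongrightarrow> (\<integral>x. 0 \<partial>(lebesgue :: (real \<times> real) measure))"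
  proof (rule integral_dominated_convergence)
    show "integrable lebesgue (\<lambda>x. 4 * (w x)\<^sup>2)"
      using w by simp
    show "AE x in lebesgue. (\<lambda>n. (cmod (F n x - f x))\<^sup>2) \<longlonglongrightarrow> 0"
    proof (rule AE_I2)
      fix x
      from lim[of x] have "(\<lambda>n. (cmod (F n x - f x))\<^sup>2) \<longlonglongrightarrow> (cmod (f x - f x))\<^sup>2"
        by (intro tendsto_intros)
      then show "(\<lambda>n. (cmod (F n x - f x))\<^sup>2) \<longlonglongrightarrow> 0" by simp
    qed
    show "AE x in lebesgue. norm ((cmod (F n x - f x))\<^sup>2) \<le> 4 * (w x)\<^sup>2" for n
    proof (rule AE_I2)
      fix x :: "real \<times> real"
      have "cmod (F n x - f x) \<le> 2 * w x"
        using norm_triangle_ineq4[of "F n x" "f x"] w(2)[of n x] fw[of x] by simp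
      from power_mono[OF this, of 2] show "norm ((cmod (F n x - f x))\<^sup>2) \<le> 4 * (w x)\<^sup>2"
        by (simp add: power_mult_distrib)
    qed
  qed auto
  then have conv: "(\<lambda>n. \<integral>x. (cmod (F n x - f x))\<^sup>2 \<partial>lebesgue) \<longlonglongrightarrow> 0" by simp
  show ?thesis
    unfolding step_approximable_def
  proof (intro conjI allI impI sqf)
    fix \<epsilon> :: real assume "\<epsilon> > 0"
    then have \<epsilon>: "\<epsilon> / 4 > 0" by simp
    from order_tendstoD(2)[OF conv this] obtain n
      where n: "(\<integral>x. (cmod (F n x - f x))\<^sup>2 \<partial>lebesgue) < \<epsilon> / 4"
      by (auto simp: eventually_sequentially)
    from F[of n] \<epsilon> obtain s where s: "valid_steps s"
      "(\<integral>x. (cmod (step_fun s x - F n x))\<^sup>2 \<partial>lebesgue) < \<epsilon> / 4"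
      unfolding step_approximable_def by meson
    have "(\<integral>x. (cmod (step_fun s x - f x))\<^sup>2 \<partial>lebesgue) < \<epsilon>"
      using n s integral_cmod_add_power2_le[of lebesgue "\<lambda>x. step_fun s x - F n x" "\<lambda>x. F n x - f x"]
      by (simp add: sq_integrable_diff sq_integrable_step_fun sqF sqf)
    with s show "\<exists>u. valid_steps u \<and> (\<integral>x. (cmod (step_fun u x - f x))\<^sup>2 \<partial>lebesgue) < \<epsilon>" by blast
  qed
qed

text \<open>In the product order \<open>{..b}\<close> is a closed lower left quadrant, which cuts a
  half-open rectangle out of a half-open rectangle.\<close>

lemma step_approximable_atMost_Int_rectangle:
  assumes "fst p \<le> fst q" "snd p \<le> snd q"
  shows "step_approximable (indicator ({..b} \<inter> rectangle p q))"
proof -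
  \<comment> \<open>The coordinates of \<open>b\<close> are clamped between those of
    \<open>p\<close> and \<open>q\<close>, so the corners stay ordered even when the intersection is
    empty.\<close>
  let ?b = "(max (fst p) (min (fst q) (fst b)), max (snd p) (min (snd q) (snd b)))"
  have "{..b} \<inter> rectangle p q = rectangle p ?b"
    using assms by (auto simp: rectangle_def less_eq_prod_def)
  then show ?thesis
    by (simp add: step_approximable_rectangle)
qed

text \<open>Dynkin's argument: the quadrants are closed under intersection and generate the Borel
  sets. Cutting down to one fixed rectangle keeps measures finite, so that complements remain in the
  class.\<close>

lemma step_approximable_indicator_Int_rectangle:
  assumes A: "A \<in> sets borel" and pq: "fst p \<le> fst q" "snd p \<le> snd q"
  shows "step_approximable (indicator (A \<inter> rectangle p q))"
proof -
  let ?G = "range (\<lambda>b :: real \<times> real. {..b})"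
  let ?R = "rectangle p q"
  have stable: "Int_stable ?G"
  proof -
    have "{..b} \<inter> {..c} = {..inf b c}" for b c :: "real \<times> real"
      by auto
    then show ?thesis by (auto simp: Int_stable_def)
  qed
  have borel: "sets borel = sigma_sets UNIV ?G"
    by (subst borel_eq_atMost) simp
  from A have "A \<in> sigma_sets UNIV ?G" by (simp add: borel)
  with stable subset_UNIV[of ?G, folded Pow_UNIV] show ?thesis
  proof (induction rule: sigma_sets_induct_disjoint)
    case (basic A)
    then show ?case using step_approximable_atMost_Int_rectangle[OF pq] by auto
  next
    case empty
    then show ?case using step_approximable_zero by (simp add: indicator_def[abs_def])
  next
    case (compl A)
    have "indicator ((UNIV - A) \<inter> ?R) = (\<lambda>x. indicator ?R x - indicator (A \<inter> ?R) x :: complex)"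
      by (auto simp: indicator_def fun_eq_iff)
    then show ?case
      using step_approximable_diff[OF step_approximable_rectangle[OF pq] compl.IH] by simp
  next
    case (union A)
    have A_borel: "A i \<in> sets borel" for i
      using union.hyps(2) by (auto simp: borel)
    show ?case
    proof (rule step_approximable_dominated)
      show "step_approximable (\<lambda>x. \<Sum>i<n. indicator (A i \<inter> ?R) x)" for n
        by (intro step_approximable_sum union.IH)
      \<comment> \<open>By disjointness the partial sums are again indicators, hence dominated by
        that of the rectangle.\<close>
      have eq: "(\<Sum>i<n. indicator (A i \<inter> ?R) x) = (indicator (\<Union>i<n. A i \<inter> ?R) x :: complex)" for n x
        using union.hyps(1)
        by (intro indicator_UN_disjoint[symmetric]) (auto simp: disjoint_family_on_def)
      show "(\<lambda>n. \<Sum>i<n. indicator (A i \<inter> ?R) x) \<longlonglongrightarrow> (indicator ((\<Union>i. A i) \<inter> ?R) x :: complex)" for x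
        unfolding eq Int_UN_distrib2 UN_extend_simps by (rule LIMSEQ_indicator_UN)
      show "cmod (\<Sum>i<n. indicator (A i \<inter> ?R) x) \<le> indicator ?R x" for n x
        unfolding eq by (auto simp: indicator_def)
      show "indicator ((\<Union>i. A i) \<inter> ?R) \<in> borel_measurable lebesgue"
        using A_borel by (intro borel_measurable_indicator sets_completionI_sets) auto
      show "integrable lebesgue (\<lambda>x. (indicator ?R x :: real)\<^sup>2)"
        using rectangle_finite_measure[of p q] by (simp add: power2_eq_square flip: indicator_inter_arith)
    qed
  qed
qed

text \<open>Up to a null set \<open>A\<close> is a Borel set \<open>S\<close>, and \<open>S\<close>
  is exhausted by its intersections with growing squares; the indicator of \<open>S\<close> is the
  square integrable majorant.\<close>

lemma step_approximable_indicator: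
  assumes A: "A \<in> sets lebesgue" "emeasure lebesgue A < \<infinity>"
  shows "step_approximable (indicator A)"
proof -
  from A(1) obtain S N N' where S: "A = S \<union> N" "N \<subseteq> N'" "N' \<in> null_sets lborel" "S \<in> sets lborel"
    by (rule sets_completionE)
  have AE_eq: "AE x in lebesgue. indicator S x = (indicator A x :: complex)"
    using S(1,2) AE_completion[OF AE_not_in[OF S(3)]] by (auto simp: indicator_def)
  have "emeasure lebesgue S \<le> emeasure lebesgue A"
    using S A by (intro emeasure_mono) auto
  with A(2) have finS: "emeasure lebesgue S < \<infinity>"
    by (simp add: order_le_less_trans)
  define R :: "nat \<Rightarrow> (real \<times> real) set"
    where "R n = rectangle (- real n, - real n) (real n, real n)" for n
  have "step_approximable (indicator S)"
  proof (rule step_approximable_dominated)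
    show "step_approximable (indicator (S \<inter> R n))" for n
      unfolding R_def using S by (intro step_approximable_indicator_Int_rectangle) auto
    show "indicator S \<in> borel_measurable lebesgue"
      using S by (intro borel_measurable_indicator sets_completionI_sets)
    show "(\<lambda>n. indicator (S \<inter> R n) x) \<longlonglongrightarrow> (indicator S x :: complex)" for x
    proof -
      obtain u v where x: "x = (u, v)" by fastforce
      obtain n :: nat where "max \<bar>u\<bar> \<bar>v\<bar> < real n"
        using reals_Archimedean2 by blast
      then have "x \<in> R n" by (auto simp: R_def rectangle_def x)
      have "incseq (\<lambda>n. S \<inter> R n)"
        by (auto simp: incseq_def R_def rectangle_def)
      from LIMSEQ_indicator_incseq[OF this, of x]
      have "(\<lambda>n. indicator (S \<inter> R n) x) \<longlonglongrightarrow> (indicator (\<Union>n. S \<inter> R n) x :: complex)" .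
      moreover have "indicator (\<Union>n. S \<inter> R n) x = (indicator S x :: complex)"
        using \<open>x \<in> R n\<close> by (auto simp: indicator_def)
      ultimately show ?thesis by simp
    qed
    show "integrable lebesgue (\<lambda>x. (indicator S x :: real)\<^sup>2)"
      using S finS by (simp add: power2_eq_square flip: indicator_inter_arith)
    show "cmod (indicator (S \<inter> R n) x) \<le> indicator S x" for n x
      by (auto simp: indicator_def)
  qed
  then show ?thesis
    by (rule step_approximable_cong_AE[OF _ _ AE_eq]) (intro borel_measurable_indicator A(1))
qed

text \<open>Simple functions bounded by \<open>2 * cmod (f x)\<close> converge to \<open>f\<close>
  pointwise, so it suffices to treat the indicators of their level sets.\<close>

lemma sq_integrable_imp_step_approximable:
  assumes f: "sq_integrable lebesgue f"
  shows "step_approximable f"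
proof -
  note [measurable] = sq_integrable_measurable[OF f]
  obtain F where F: "\<And>i. simple_function lebesgue (F i)" "\<And>x. (\<lambda>i. F i x) \<longlonglongrightarrow> f x"
    "\<And>i x. dist (F i x) 0 \<le> 2 * dist (f x) 0"
    using borel_measurable_implies_sequence_metric[of f lebesgue 0] by auto
  show ?thesis
  proof (rule step_approximable_dominated)
    show "(\<lambda>i. F i x) \<longlonglongrightarrow> f x" for x by (rule F)
    show "cmod (F i x) \<le> 2 * cmod (f x)" for i x using F(3) by simp
    show "integrable lebesgue (\<lambda>x. (2 * cmod (f x))\<^sup>2)"
      using sq_integrable_power2[OF f] by (simp add: power_mult_distrib)
    show "step_approximable (F i)" for i
    proof -
      have fin: "finite (range (F i))" and [measurable]: "F i \<in> borel_measurable lebesgue"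
        using F(1)[of i] by (auto simp: simple_function_def borel_measurable_simple_function)
      have "step_approximable (\<lambda>x. y * indicator (F i -` {y}) x)" for y
      \<comment> \<open>The level set of 0 may have infinite measure, but it contributes nothing;
        the others have finite measure by Chebyshev's inequality.\<close>
      proof (cases "y = 0")
        case True
        then show ?thesis using step_approximable_zero by simp
      next
        case False
        have meas: "F i -` {y} \<in> sets lebesgue"
          using measurable_sets[of "F i" lebesgue borel "{y}"] by simp
        have "integrable lebesgue (\<lambda>x. (cmod y)\<^sup>2 * indicator (F i -` {y}) x)"
        proof (rule Bochner_Integration.integrable_bound)
          show "integrable lebesgue (\<lambda>x. (2 * cmod (f x))\<^sup>2)" by fact
          show "AE x in lebesgue. norm ((cmod y)\<^sup>2 * indicator (F i -` {y}) x) \<le> norm ((2 * cmod (f x))\<^sup>2)"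
          proof (rule AE_I2)
            fix x
            show "norm ((cmod y)\<^sup>2 * indicator (F i -` {y}) x) \<le> norm ((2 * cmod (f x))\<^sup>2)"
              using power_mono[OF \<open>\<And>i x. cmod (F i x) \<le> 2 * cmod (f x)\<close>[of i x], of 2]
              by (auto simp: indicator_def)
          qed
        qed (use meas in measurable)
        with False have "integrable lebesgue (indicator (F i -` {y}) :: _ \<Rightarrow> real)" by simp
        with meas have "emeasure lebesgue (F i -` {y}) < \<infinity>"
          by (simp add: integrable_indicator_iff)
        then show ?thesis
          by (intro step_approximable_cmult step_approximable_indicator meas)
      qed
      then have "step_approximable (\<lambda>x. \<Sum>y\<in>range (F i). y * indicator (F i -` {y}) x)"
        by (rule step_approximable_sum)
      moreover have "(\<Sum>y\<in>range (F i). y * indicator (F i -` {y}) x) = F i x" for x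
        using fin by (simp add: indicator_def if_distrib sum.delta cong: if_cong)
      ultimately show ?thesis by simp
    qed
  qed measurable
qed

lemma integral_indicator_rectangle_mult_cnj:
  "(\<integral>x. indicator (rectangle p q) x * cnj (indicator (rectangle p' q') x) \<partial>lebesgue) =
    complex_of_real (measure lebesgue (rectangle p q \<inter> rectangle p' q'))"
proof -
  have "(\<lambda>x. indicator (rectangle p q) x * cnj (indicator (rectangle p' q') x)) =
      (\<lambda>x. complex_of_real (indicator (rectangle p q \<inter> rectangle p' q') x))"
    by (auto simp: indicator_def fun_eq_iff)
  then show ?thesis by simp
qed

section \<open>The Wiener integral\<close>

text \<open>The right-hand side is the length of the overlap of \<open>{a<..b}\<close> and
  \<open>{c<..d}\<close>. For nonnegative arguments \<open>min\<close> is the Brownian covariance,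
  and the left-hand side is the covariance of two increments.\<close>

lemma min_increment:
  fixes a b c d :: real
  assumes "a \<le> b" "c \<le> d"
  shows "min b d - min a d - min b c + min a c = max 0 (min b d - max a c)"
  using assms by (simp add: min_def max_def)

text \<open>The one-dimensional core of the isometry: increments of a two-sided Brownian motion have
  the length of the overlap as covariance, also across the origin.\<close>

lemma two_sided_min_increment:
  assumes "a \<le> b" "c \<le> d"
  shows "two_sided_min b d - two_sided_min a d - two_sided_min b c + two_sided_min a c =
    max 0 (min b d - max a c)"
proof -
  \<comment> \<open>Splitting into positive and negative parts keeps the case analysis small.\<close>
  define P N where "P x = max 0 x" and "N x = max 0 (- x)" for x :: real
  have eq: "two_sided_min s t = min (P s) (P t) + min (N s) (N t)" for s t
  proof -
    consider "s > 0" "t > 0" | "s < 0" "t < 0" | "s > 0" "t < 0" | "s < 0" "t > 0" | "s = 0" | "t = 0"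
      by linarith
    then show ?thesis
      by cases (auto simp: P_def N_def two_sided_min_def zero_le_mult_iff)
  qed
  have PN: "P a \<le> P b" "P c \<le> P d" "N b \<le> N a" "N d \<le> N c"
    using assms by (auto simp: P_def N_def)
  \<comment> \<open>The length of an interval is that of its positive part plus that of its negative
    part; for reversed endpoints all terms are 0.\<close>
  have *: "max 0 (P v - P u) + max 0 (N u - N v) = max 0 (v - u)" for u v
    by (simp add: P_def N_def max_def)
  have lat: "min (P b) (P d) = P (min b d)" "max (P a) (P c) = P (max a c)"
    "min (N a) (N c) = N (max a c)" "max (N b) (N d) = N (min b d)"
    by (simp_all add: P_def N_def min_def max_def)
  show ?thesis
    unfolding eq *[of "min b d" "max a c", symmetric]
    using min_increment[OF PN(1,2)] min_increment[OF PN(3,4)] unfolding lat by linarith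
qed

lemma measure_rectangle_Int:
  assumes "fst p \<le> fst q" "snd p \<le> snd q" "fst p' \<le> fst q'" "snd p' \<le> snd q'"
  shows "measure lebesgue (rectangle p q \<inter> rectangle p' q') =
    max 0 (min (fst q) (fst q') - max (fst p) (fst p')) *
    max 0 (min (snd q) (snd q') - max (snd p) (snd p'))"
proof -
  have Ioc: "emeasure lborel {x<..y} = ennreal (max 0 (y - x))" for x y :: real
    by (cases "x \<le> y") (auto simp: max_def)
  have "rectangle p q \<inter> rectangle p' q' =
      {max (fst p) (fst p')<..min (fst q) (fst q')} \<times> {max (snd p) (snd p')<..min (snd q) (snd q')}"
    by (auto simp: rectangle_def)
  then have "emeasure lebesgue (rectangle p q \<inter> rectangle p' q') =
      emeasure (lborel \<Otimes>\<^sub>M lborel)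
      ({max (fst p) (fst p')<..min (fst q) (fst q')} \<times> {max (snd p) (snd p')<..min (snd q) (snd q')})"
    by (simp add: lborel_prod borel_Times)
  also have "\<dots> = ennreal (max 0 (min (fst q) (fst q') - max (fst p) (fst p')) *
      max 0 (min (snd q) (snd q') - max (snd p) (snd p')))"
    by (subst lborel.emeasure_pair_measure_Times) (simp_all add: Ioc ennreal_mult)
  finally show ?thesis
    by (simp add: measure_def)
qed

text \<open>Puts the sheet into L2. A degenerate variable has no density and is almost surely
  constant; otherwise the moments of the normal density apply.\<close>

lemma gaussian_imp_integrable_power2:
  assumes M: "prob_space M" and X: "gaussian M X"
  shows "integrable M (\<lambda>\<omega>. (X \<omega>)\<^sup>2)"
proof -
  interpret prob_space M by fact
  have [measurable]: "X \<in> borel_measurable M"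
    using X by (simp add: gaussian_def)
  from X consider \<mu> where "AE \<omega> in M. X \<omega> = \<mu>"
    | \<mu> s where "s > 0" "distributed M lborel X (normal_density \<mu> s)"
    unfolding gaussian_def by blast
  then show ?thesis
  proof cases
    case (1 \<mu>)
    then have "AE \<omega> in M. (X \<omega>)\<^sup>2 = \<mu>\<^sup>2"
      by eventually_elim simp
    then have "integrable M (\<lambda>\<omega>. (X \<omega>)\<^sup>2) \<longleftrightarrow> integrable M (\<lambda>\<omega>. \<mu>\<^sup>2)"
      by (intro integrable_cong_AE) auto
    then show ?thesis by simp
  next
    case (2 \<mu> s)
    \<comment> \<open>This is \<open>x\<^sup>2\<close> expanded around \<mu>, since
      \<open>integrable_normal_moment\<close> speaks of centred moments.\<close>
    have "integrable lborel (\<lambda>x. normal_density \<mu> s x * (x - \<mu>)^2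
        + 2 * \<mu> * (normal_density \<mu> s x * (x - \<mu>)^1) + \<mu>\<^sup>2 * normal_density \<mu> s x)"
      using 2(1) integrable_normal_moment[of s \<mu> 2] integrable_normal_moment[of s \<mu> 1]
      by (intro Bochner_Integration.integrable_add integrable_mult_right) auto
    also have "(\<lambda>x. normal_density \<mu> s x * (x - \<mu>)^2
        + 2 * \<mu> * (normal_density \<mu> s x * (x - \<mu>)^1) + \<mu>\<^sup>2 * normal_density \<mu> s x) =
        (\<lambda>x. normal_density \<mu> s x * x\<^sup>2)"
      by (auto simp: fun_eq_iff power2_eq_square algebra_simps)
    finally show ?thesis
      using distributed_integrable[OF 2(2), of "\<lambda>x. x\<^sup>2"] by simp
  qed
qed

lemma gaussian_process_imp_gaussian:
  assumes "gaussian_process M X"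
  shows "gaussian M (X t)"
  using assms[unfolded gaussian_process_def, rule_format, of "{t}" "\<lambda>_. 1"] by simp

section \<open>Increments of a fixed sheet and integrals of step functions\<close>

locale sheet =
  fixes M :: "'w measure" and W :: "real \<times> real \<Rightarrow> 'w \<Rightarrow> real"
  assumes brownian: "brownian_sheet M W"
begin

sublocale prob_space M
  using brownian by (simp add: brownian_sheet_def)

lemma sheet_measurable [measurable]: "W t \<in> borel_measurable M"
  using brownian gaussian_process_imp_gaussian[of M W t]
  unfolding brownian_sheet_def gaussian_def by blast

lemma sq_integrable_sheet: "sq_integrable M (\<lambda>\<omega>. complex_of_real (W t \<omega>))"
  using brownian gaussian_imp_integrable_power2[OF _ gaussian_process_imp_gaussian, of M W t]
  by (auto simp: brownian_sheet_def sq_integrable_def)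

lemma integrable_sheet_mult [simp]: "integrable M (\<lambda>\<omega>. W s \<omega> * W t \<omega>)"
  using integrable_mult_cnj[OF sq_integrable_sheet[of s] sq_integrable_sheet[of t]]
  by (simp flip: of_real_mult add: complex_of_real_integrable_eq)

lemma sq_integrable_one: "sq_integrable M (\<lambda>\<omega>. 1)"
  by (simp add: sq_integrable_def)

text \<open>On a probability space the constant 1 is square integrable and can serve as the second
  factor in \<open>integrable_mult_cnj\<close>.\<close>

lemma sq_integrable_imp_integrable: "sq_integrable M f \<Longrightarrow> integrable M f"
  using integrable_mult_cnj[OF _ sq_integrable_one] by simp

lemma integrable_sheet [simp]: "integrable M (W t)"
  using sq_integrable_imp_integrable[OF sq_integrable_sheet[of t]]
  by (simp add: complex_of_real_integrable_eq)

lemma sq_integrable_increment: "sq_integrable M (\<lambda>\<omega>. complex_of_real (increment W p q \<omega>))"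
  unfolding increment_def of_real_add of_real_diff
  by (intro sq_integrable_add sq_integrable_diff sq_integrable_sheet)

lemma integral_increment: "(\<integral>\<omega>. increment W p q \<omega> \<partial>M) = 0"
proof -
  have "(\<integral>\<omega>. W t \<omega> \<partial>M) = 0" for t
    using brownian unfolding brownian_sheet_def by blast
  then show ?thesis by (simp add: increment_def)
qed

text \<open>The covariance of the sheet is a product over the coordinates, so the sixteen terms
  factor into two one-dimensional mixed differences, whose values are the side lengths of the
  overlap.\<close>

lemma integral_increment_mult:
  assumes "fst p \<le> fst q" "snd p \<le> snd q" "fst p' \<le> fst q'" "snd p' \<le> snd q'"
  shows "(\<integral>\<omega>. increment W p q \<omega> * increment W p' q' \<omega> \<partial>M) =
    measure lebesgue (rectangle p q \<inter> rectangle p' q')"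
proof -
  let ?m = two_sided_min
  have cov: "(\<integral>\<omega>. W s \<omega> * W t \<omega> \<partial>M) = ?m (fst s) (fst t) * ?m (snd s) (snd t)" for s t
    using brownian unfolding brownian_sheet_def by blast
  have "(\<integral>\<omega>. increment W p q \<omega> * increment W p' q' \<omega> \<partial>M) =
      (?m (fst q) (fst q') - ?m (fst p) (fst q') - ?m (fst q) (fst p') + ?m (fst p) (fst p')) *
      (?m (snd q) (snd q') - ?m (snd p) (snd q') - ?m (snd q) (snd p') + ?m (snd p) (snd p'))"
    unfolding increment_def ring_distribs
    by (simp add: cov)
  then show ?thesis
    unfolding measure_rectangle_Int[OF assms] two_sided_min_increment[OF assms(1,3)]
      two_sided_min_increment[OF assms(2,4)] .
qed

lemma sq_integrable_step_integral: "sq_integrable M (step_integral W s)"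
  unfolding step_integral_def[abs_def] by (intro sq_integrable_sum_list sq_integrable_increment)

lemma integral_step_integral: "(\<integral>\<omega>. step_integral W s \<omega> \<partial>M) = 0"
  unfolding step_integral_def
  by (subst integral_sum_list(2))
     (simp_all add: sq_integrable_imp_integrable[OF sq_integrable_increment] integral_increment split_def)

text \<open>Both sides expand into the same double sum over pairs of entries, and the Gram matrices
  of increments and indicators agree. The rectangles may therefore overlap or repeat.\<close>

lemma step_integral_isometry:
  assumes "valid_steps s" "valid_steps t"
  shows "(\<integral>\<omega>. step_integral W s \<omega> * cnj (step_integral W t \<omega>) \<partial>M) =
    (\<integral>x. step_fun s x * cnj (step_fun t x) \<partial>lebesgue)"
proof -
  have "(\<integral>\<omega>. complex_of_real (increment W p q \<omega>) * cnj (complex_of_real (increment W p' q' \<omega>)) \<partial>M) =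
      (\<integral>x. indicator (rectangle p q) x * cnj (indicator (rectangle p' q') x) \<partial>lebesgue)"
    if "(c, p, q) \<in> set s" "(c', p', q') \<in> set t" for c p q c' p' q'
  proof -
    have "fst p \<le> fst q" "snd p \<le> snd q" "fst p' \<le> fst q'" "snd p' \<le> snd q'"
      using assms that by (auto simp: valid_steps_def)
    from integral_increment_mult[OF this] show ?thesis
      by (simp flip: of_real_mult add: integral_indicator_rectangle_mult_cnj)
  qed
  then show ?thesis
    unfolding step_integral_def step_fun_def
    using rectangle_finite_measure
    by (subst (1 2) integral_sum_list_mult_cnj)
       (auto intro!: sq_integrable_increment sq_integrable_indicator arg_cong[of _ _ sum_list] map_cong)
qed

lemma step_integral_dist:
  assumes "valid_steps s" "valid_steps t"
  shows "(\<integral>\<omega>. (cmod (step_integral W s \<omega> - step_integral W t \<omega>))\<^sup>2 \<partial>M) =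
    (\<integral>x. (cmod (step_fun s x - step_fun t x))\<^sup>2 \<partial>lebesgue)"
proof -
  \<comment> \<open>A list representing the difference, with \<open>-1 * c\<close> left unsimplified
    to match \<open>step_fun_scale\<close>; the isometry is applied to it twice.\<close>
  let ?u = "s @ map (\<lambda>(c, r). (-1 * c, r)) t"
  have I: "step_integral W ?u \<omega> = step_integral W s \<omega> - step_integral W t \<omega>" for \<omega>
  proof -
    have "step_integral W (map (\<lambda>(c, r). (-1 * c, r)) t) \<omega> = - step_integral W t \<omega>"
      by (induction t) (auto simp: step_integral_def)
    then show ?thesis by (simp add: step_integral_def)
  qed
  have S: "step_fun ?u x = step_fun s x - step_fun t x" for x
    unfolding step_fun_append step_fun_scale by simp
  have "valid_steps ?u"
    using assms unfolding valid_steps_simps by simp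
  from step_integral_isometry[OF this this]
  have "(\<integral>\<omega>. complex_of_real ((cmod (step_integral W s \<omega> - step_integral W t \<omega>))\<^sup>2) \<partial>M) =
      (\<integral>x. complex_of_real ((cmod (step_fun s x - step_fun t x))\<^sup>2) \<partial>lebesgue)"
    unfolding I S complex_norm_square by simp
  then show ?thesis
    unfolding integral_complex_of_real of_real_eq_iff .
qed

text \<open>Step functions are chosen at squared distance below \<open>(1/4) ^ n\<close>. The
  isometry turns this into the rate that \<open>L2_complete_fast\<close> requires of their
  integrals.\<close>

lemma has_wiener_integral_exists:
  assumes \<psi>: "sq_integrable lebesgue \<psi>"
  shows "\<exists>I. has_wiener_integral M W \<psi> I"
proof -
  have "\<exists>s. valid_steps s \<and> (\<integral>x. (cmod (step_fun s x - \<psi> x))\<^sup>2 \<partial>lebesgue) < (1/4) ^ n" for n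
    using sq_integrable_imp_step_approximable[OF \<psi>] by (simp add: step_approximable_def)
  then obtain s where s: "\<And>n. valid_steps (s n)"
    "\<And>n. (\<integral>x. (cmod (step_fun (s n) x - \<psi> x))\<^sup>2 \<partial>lebesgue) < (1/4) ^ n"
    by metis
  have sq: "sq_integrable lebesgue (\<lambda>x. step_fun (s n) x - \<psi> x)" for n
    by (intro sq_integrable_diff sq_integrable_step_fun \<psi>)
  have "(\<integral>\<omega>. (cmod (step_integral W (s m) \<omega> - step_integral W (s n) \<omega>))\<^sup>2 \<partial>M) \<le> 4 * (1/4) ^ n"
    if "n \<le> m" for n m
  proof -
    have "(\<integral>\<omega>. (cmod (step_integral W (s m) \<omega> - step_integral W (s n) \<omega>))\<^sup>2 \<partial>M) =
        (\<integral>x. (cmod ((step_fun (s m) x - \<psi> x) + (-1) * (step_fun (s n) x - \<psi> x)))\<^sup>2 \<partial>lebesgue)"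
      by (subst step_integral_dist[OF s(1) s(1)]) simp
    also have "\<dots> \<le> 2 * (\<integral>x. (cmod (step_fun (s m) x - \<psi> x))\<^sup>2 \<partial>lebesgue) +
        2 * (\<integral>x. (cmod ((-1) * (step_fun (s n) x - \<psi> x)))\<^sup>2 \<partial>lebesgue)"
      by (intro integral_cmod_add_power2_le sq_integrable_cmult sq)
    also have "\<dots> \<le> 2 * (1/4) ^ m + 2 * (1/4) ^ n"
      using s(2)[of m] s(2)[of n] by (simp add: norm_minus_commute)
    also have "(1/4 :: real) ^ m \<le> (1/4) ^ n"
      using that by (intro power_decreasing) auto
    finally show ?thesis by simp
  qed
  from L2_complete_fast[OF sq_integrable_step_integral this]
  obtain I where I: "I \<in> borel_measurable M"
    "(\<lambda>n. \<integral>\<^sup>+\<omega>. ennreal ((cmod (step_integral W (s n) \<omega> - I \<omega>))\<^sup>2) \<partial>M) \<longlonglongrightarrow> 0"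
    by blast
  have "(\<integral>\<^sup>+x. ennreal ((cmod (step_fun (s n) x - \<psi> x))\<^sup>2) \<partial>lebesgue) \<le> ennreal ((1/4) ^ n)" for n
    using s(2)[of n] sq_integrable_power2[OF sq[of n]]
    by (subst nn_integral_eq_integral) (auto intro: ennreal_leI)
  moreover have "(\<lambda>n. ennreal ((1/4) ^ n)) \<longlonglongrightarrow> ennreal 0"
    by (intro tendsto_ennrealI LIMSEQ_power_zero) simp
  ultimately have "(\<lambda>n. \<integral>\<^sup>+x. ennreal ((cmod (step_fun (s n) x - \<psi> x))\<^sup>2) \<partial>lebesgue) \<longlonglongrightarrow> 0"
    by - (rule tendsto_sandwich[OF _ _ tendsto_const], auto intro!: always_eventually)
  with s I show ?thesis
    using sq_integrable_measurable[OF \<psi>] unfolding has_wiener_integral_def by blast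
qed

lemma has_wiener_integral_sq_integrable:
  assumes "has_wiener_integral M W \<psi> I"
  shows "sq_integrable lebesgue \<psi>" "sq_integrable M I"
  using assms sq_integrable_limit[of lebesgue "\<lambda>n. step_fun (_ n)" \<psi>]
    sq_integrable_limit[of M "\<lambda>n. step_integral W (_ n)" I]
    sq_integrable_step_fun sq_integrable_step_integral
  unfolding has_wiener_integral_def by blast+

text \<open>Stated for arbitrary versions \<open>I\<close> and \<open>J\<close>, so it applies to
  whichever version \<open>wiener_integral\<close> selects. The isometry for the approximating steps
  passes to the limit on both sides.\<close>

lemma wiener_isometry:
  assumes I: "has_wiener_integral M W \<psi> I" and J: "has_wiener_integral M W \<xi> J"
  shows "(\<integral>\<omega>. I \<omega> * cnj (J \<omega>) \<partial>M) = (\<integral>x. \<psi> x * cnj (\<xi> x) \<partial>lebesgue)"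
proof -
  obtain s where s: "\<And>n. valid_steps (s n)"
    "(\<lambda>n. \<integral>\<^sup>+y. ennreal ((cmod (step_fun (s n) y - \<psi> y))\<^sup>2) \<partial>lebesgue) \<longlonglongrightarrow> 0"
    "(\<lambda>n. \<integral>\<^sup>+\<omega>. ennreal ((cmod (step_integral W (s n) \<omega> - I \<omega>))\<^sup>2) \<partial>M) \<longlonglongrightarrow> 0"
    using I unfolding has_wiener_integral_def by blast
  obtain t where t: "\<And>n. valid_steps (t n)"
    "(\<lambda>n. \<integral>\<^sup>+y. ennreal ((cmod (step_fun (t n) y - \<xi> y))\<^sup>2) \<partial>lebesgue) \<longlonglongrightarrow> 0"
    "(\<lambda>n. \<integral>\<^sup>+\<omega>. ennreal ((cmod (step_integral W (t n) \<omega> - J \<omega>))\<^sup>2) \<partial>M) \<longlonglongrightarrow> 0"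
    using J unfolding has_wiener_integral_def by blast
  note sq = has_wiener_integral_sq_integrable[OF I] has_wiener_integral_sq_integrable[OF J]
  have "(\<lambda>n. \<integral>\<omega>. step_integral W (s n) \<omega> * cnj (step_integral W (t n) \<omega>) \<partial>M) \<longlonglongrightarrow>
      (\<integral>\<omega>. I \<omega> * cnj (J \<omega>) \<partial>M)"
    using sq s t by (intro tendsto_integral_mult_cnj sq_integrable_step_integral)
  moreover have "(\<lambda>n. \<integral>x. step_fun (s n) x * cnj (step_fun (t n) x) \<partial>lebesgue) \<longlonglongrightarrow>
      (\<integral>x. \<psi> x * cnj (\<xi> x) \<partial>lebesgue)"
    using sq s t by (intro tendsto_integral_mult_cnj sq_integrable_step_fun)
  ultimately show ?thesis
    using step_integral_isometry[OF s(1) t(1)] LIMSEQ_unique by fastforce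
qed

text \<open>The mean is the inner product with the constant 1, hence continuous in L2, and it
  vanishes for step functions.\<close>

lemma wiener_integral_mean_zero:
  assumes I: "has_wiener_integral M W \<psi> I"
  shows "(\<integral>\<omega>. I \<omega> \<partial>M) = 0"
proof -
  obtain s where s: "(\<lambda>n. \<integral>\<^sup>+\<omega>. ennreal ((cmod (step_integral W (s n) \<omega> - I \<omega>))\<^sup>2) \<partial>M) \<longlonglongrightarrow> 0"
    using I unfolding has_wiener_integral_def by blast
  have "(\<lambda>n. \<integral>\<omega>. step_integral W (s n) \<omega> * cnj ((\<lambda>_. 1) \<omega>) \<partial>M) \<longlonglongrightarrow> (\<integral>\<omega>. I \<omega> * cnj ((\<lambda>_. 1) \<omega>) \<partial>M)"
    using s has_wiener_integral_sq_integrable[OF I]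
    by (intro tendsto_integral_mult_cnj sq_integrable_step_integral sq_integrable_one) auto
  then show ?thesis
    by (simp add: integral_step_integral LIMSEQ_const_iff)
qed

lemma has_wiener_integral_wiener_integral:
  assumes "sq_integrable lebesgue (\<lambda>y. indicator S y * \<psi> y)"
  shows "has_wiener_integral M W (\<lambda>y. indicator S y * \<psi> y) (wiener_integral M W S \<psi>)"
  unfolding wiener_integral_def using has_wiener_integral_exists[OF assms] by (rule someI_ex)

end

section \<open>Covariance of the far field\<close>

text \<open>This removes the contribution of \<open>g\<close>, a constant in \<omega>. Integrability
  ensures that the means split; the Bochner integral of a non-integrable function is 0 by
  default.\<close>

lemma covariance_add_const:
  assumes "prob_space M" "integrable M u" "integrable M v"
  shows "covariance M (\<lambda>\<omega>. b + u \<omega>) (\<lambda>\<omega>. c + v \<omega>) = covariance M u v"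
proof -
  interpret prob_space M by fact
  show ?thesis using assms by (simp add: covariance_def prob_space)
qed

lemma far_field_kernel_cmod: "k > 0 \<Longrightarrow> (cmod (far_field_kernel k d y))\<^sup>2 = 1 / (8 * pi * k)"
  by (simp add: far_field_kernel_def norm_mult norm_divide power_mult_distrib power_divide)

text \<open>The kernel has constant modulus, so only \<sigma> matters; on a domain of finite measure
  \<open>\<sigma>\<^sup>2\<close> in L2 implies \<open>\<sigma>\<^sup>2\<close> in L1.\<close>

lemma sq_integrable_far_field_integrand:
  assumes adm: "admissible_source a M W g \<sigma>" and "k > 0"
  shows "sq_integrable lebesgue (\<lambda>y. indicator (square_domain a) y * (far_field_kernel k d y * of_real (\<sigma> y)))"
proof -
  let ?S = "square_domain a"
  have S: "?S \<in> sets lebesgue"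
    by (auto simp: square_domain_def intro!: sets_completionI_sets borel_Times)
  have fin: "emeasure lebesgue ?S < \<infinity>"
  proof -
    have "?S \<subseteq> cbox (-a/2, -a/2) (a/2, a/2)"
      by (auto simp: square_domain_def cbox_Pair_eq)
    then have "bounded ?S" using bounded_cbox bounded_subset by blast
    then have "emeasure lborel ?S < \<infinity>" by (rule emeasure_bounded_finite)
    then show ?thesis by (simp add: square_domain_def borel_Times)
  qed
  have sq: "square_integrable_on (\<lambda>x. (\<sigma> x)\<^sup>2) ?S" and pos: "\<And>x. 0 \<le> \<sigma> x"
    using adm unfolding admissible_source_def by blast+
  \<comment> \<open>Admissibility gives measurability of the square only; as \<sigma> is
    nonnegative, the root recovers \<sigma> itself.\<close>
  have "(\<lambda>x. sqrt ((\<sigma> x)\<^sup>2)) \<in> borel_measurable (lebesgue_on ?S)"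
    using conjunct1[OF sq[unfolded square_integrable_on_def]]
    by (rule measurable_compose[OF _ borel_measurable_sqrt])
  then have "\<sigma> \<in> borel_measurable (lebesgue_on ?S)"
    by (rule measurable_cong[THEN iffD1, rotated]) (simp add: pos)
  then have \<sigma>: "(\<lambda>x. indicator ?S x * \<sigma> x) \<in> borel_measurable lebesgue"
    using S by (simp add: borel_measurable_restrict_space_iff)
  have K: "far_field_kernel k d \<in> borel_measurable lebesgue"
    unfolding far_field_kernel_def[abs_def] divide_inverse
    by (intro measurable_completion, unfold measurable_lborel2)
       (intro borel_measurable_continuous_onI continuous_intros)
  have meas: "(\<lambda>y. far_field_kernel k d y * of_real (indicator ?S y * \<sigma> y)) \<in> borel_measurable lebesgue"
    using K \<sigma> by measurable
  have "integrable (lebesgue_on ?S) (\<lambda>x. (\<sigma> x)\<^sup>2)"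
  proof -
    interpret finite_measure "lebesgue_on ?S"
      using fin S by (intro finite_measureI) (simp add: emeasure_restrict_space)
    show ?thesis
      by (rule square_integrable_imp_integrable) (use sq in \<open>auto simp: square_integrable_on_def\<close>)
  qed
  then have int: "integrable lebesgue (\<lambda>x. indicator ?S x * (\<sigma> x)\<^sup>2)"
    using S by (simp add: integrable_restrict_space)
  have "(\<lambda>y. (cmod (indicator ?S y * (far_field_kernel k d y * of_real (\<sigma> y))))\<^sup>2) =
      (\<lambda>y. 1 / (8 * pi * k) * (indicator ?S y * (\<sigma> y)\<^sup>2))"
    using far_field_kernel_cmod[OF \<open>k > 0\<close>]
    by (auto simp: fun_eq_iff norm_mult power_mult_distrib indicator_def)
  moreover have "(\<lambda>y. far_field_kernel k d y * of_real (indicator ?S y * \<sigma> y)) =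
      (\<lambda>y. indicator ?S y * (far_field_kernel k d y * of_real (\<sigma> y)))"
    by (auto simp: fun_eq_iff indicator_def)
  ultimately show ?thesis
    using int meas unfolding sq_integrable_def by simp
qed

text \<open>The normalisations of the two kernels multiply to
  \<open>1 / (8 * pi * sqrt (k * (k + \<tau>)))\<close>, and \<open>a\<^sup>2\<close> undoes the
  averaging factor of the Fourier coefficient.\<close>

lemma far_field_covariance:
  fixes l :: "int \<times> int" and d :: "real \<times> real"
  assumes "a > 0" "k > 0" and adm: "admissible_source a M W g \<sigma>"
  defines "\<tau> \<equiv> wavenumber_shift a l" and "x \<equiv> observation_direction d l"
  shows "covariance M (far_field a M W g \<sigma> x (k + \<tau>)) (far_field a M W g \<sigma> x k) =
    of_real (a\<^sup>2 / (8 * pi * sqrt (k * (k + \<tau>)))) * fourier_coeff a (\<lambda>x. (\<sigma> x)\<^sup>2) l"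
proof -
  interpret sheet M W
    using adm by unfold_locales (simp add: admissible_source_def)
  let ?S = "square_domain a"
  have \<tau>: "\<tau> \<ge> 0"
    using \<open>a > 0\<close> by (simp add: \<tau>_def wavenumber_shift_def)
  \<comment> \<open>At the zero frequency both sides vanish, whatever the direction
    \<open>d\<close>; otherwise the norm in \<tau> cancels the normalisation of
    \<open>x\<close>.\<close>
  have shift: "\<tau> *\<^sub>R x = (2 * pi / a) *\<^sub>R lattice_point l"
  proof (cases "l = (0, 0)")
    case True
    then show ?thesis by (simp add: \<tau>_def wavenumber_shift_def lattice_point_def zero_prod_def[symmetric])
  next
    case False
    then have "lattice_point l \<noteq> 0"
      by (cases l) (auto simp: lattice_point_def zero_prod_def)
    with False show ?thesis
      by (simp add: \<tau>_def x_def wavenumber_shift_def observation_direction_def)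
  qed
  have kernel: "far_field_kernel (k + \<tau>) x y * cnj (far_field_kernel k x y) =
      of_real (1 / (8 * pi * sqrt (k * (k + \<tau>)))) * cnj (fourier_basis a l y)" for y
  proof -
    have inner: "\<tau> * (x \<bullet> y) = 2 * pi / a * (lattice_point l \<bullet> y)"
      using arg_cong[OF shift, of "\<lambda>v. v \<bullet> y"] by simp
    have exp_mult_cnj: "exp u * cnj (exp v) = exp (u + cnj v)" for u v :: complex
      by (simp add: exp_cnj exp_add)
    have "exp (\<i> * of_real pi / 4) * cnj (exp (\<i> * of_real pi / 4)) = (1 :: complex)"
      unfolding exp_mult_cnj by simp
    moreover have "exp (- \<i> * of_real (k + \<tau>) * of_real (x \<bullet> y)) * cnj (exp (- \<i> * of_real k * of_real (x \<bullet> y))) =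
        cnj (fourier_basis a l y)"
    proof -
      have "- \<i> * of_real (k + \<tau>) * of_real (x \<bullet> y) + cnj (- \<i> * of_real k * of_real (x \<bullet> y)) =
          cnj (\<i> * of_real (\<tau> * (x \<bullet> y)))"
        by (simp add: algebra_simps)
      then show ?thesis
        unfolding fourier_basis_def inner[symmetric] exp_mult_cnj by (simp only: exp_cnj)
    qed
    moreover have "sqrt (8 * pi * (k + \<tau>)) * sqrt (8 * pi * k) = 8 * pi * sqrt (k * (k + \<tau>))"
    proof -
      have "8 * pi * (k + \<tau>) * (8 * pi * k) = (8 * pi)\<^sup>2 * (k * (k + \<tau>))"
        by (simp only: power2_eq_square mult_ac)
      then have "sqrt (8 * pi * (k + \<tau>)) * sqrt (8 * pi * k) = sqrt ((8 * pi)\<^sup>2) * sqrt (k * (k + \<tau>))"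
        by (simp only: real_sqrt_mult[symmetric])
      then show ?thesis by (simp only: real_sqrt_abs) simp
    qed
    then have "complex_of_real (sqrt (8 * pi * (k + \<tau>))) * complex_of_real (sqrt (8 * pi * k)) =
        complex_of_real (8 * pi * sqrt (k * (k + \<tau>)))"
      by (metis of_real_mult)
    ultimately show ?thesis
      unfolding far_field_kernel_def complex_cnj_mult complex_cnj_divide complex_cnj_complex_of_real
      by (simp add: mult_ac)
  qed
  let ?I = "\<lambda>k. wiener_integral M W ?S (\<lambda>y. far_field_kernel k x y * of_real (\<sigma> y))"
  have I: "has_wiener_integral M W (\<lambda>y. indicator ?S y * (far_field_kernel k x y * of_real (\<sigma> y))) (?I k)"
    if "k > 0" for k
    by (intro has_wiener_integral_wiener_integral sq_integrable_far_field_integrand[OF adm that])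
  have I1: "has_wiener_integral M W (\<lambda>y. indicator ?S y * (far_field_kernel (k + \<tau>) x y * of_real (\<sigma> y))) (?I (k + \<tau>))"
    and I2: "has_wiener_integral M W (\<lambda>y. indicator ?S y * (far_field_kernel k x y * of_real (\<sigma> y))) (?I k)"
    using \<tau> \<open>k > 0\<close> by (auto intro!: I)
  have "covariance M (far_field a M W g \<sigma> x (k + \<tau>)) (far_field a M W g \<sigma> x k) =
      covariance M (?I (k + \<tau>)) (?I k)"
    unfolding far_field_def[abs_def]
    by (intro covariance_add_const sq_integrable_imp_integrable prob_space_axioms
        has_wiener_integral_sq_integrable(2)[OF I1] has_wiener_integral_sq_integrable(2)[OF I2])
  also have "\<dots> = (\<integral>\<omega>. ?I (k + \<tau>) \<omega> * cnj (?I k \<omega>) \<partial>M)"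
    by (simp add: covariance_def wiener_integral_mean_zero[OF I1] wiener_integral_mean_zero[OF I2])
  also have "\<dots> = (\<integral>y. indicator ?S y * (far_field_kernel (k + \<tau>) x y * of_real (\<sigma> y)) *
      cnj (indicator ?S y * (far_field_kernel k x y * of_real (\<sigma> y))) \<partial>lebesgue)"
    by (rule wiener_isometry[OF I1 I2])
  \<comment> \<open>The two indicators merge into one, written with \<open>*\<^sub>R\<close> as in
    the definition of the set integral.\<close>
  also have "\<dots> = (\<integral>y. of_real (1 / (8 * pi * sqrt (k * (k + \<tau>)))) *
      (indicator ?S y *\<^sub>R (of_real ((\<sigma> y)\<^sup>2) * cnj (fourier_basis a l y))) \<partial>lebesgue)"
  proof (intro Bochner_Integration.integral_cong refl)
    fix y
    have "indicator ?S y * (far_field_kernel (k + \<tau>) x y * of_real (\<sigma> y)) *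
        cnj (indicator ?S y * (far_field_kernel k x y * of_real (\<sigma> y))) =
        (far_field_kernel (k + \<tau>) x y * cnj (far_field_kernel k x y)) * (indicator ?S y *\<^sub>R of_real ((\<sigma> y)\<^sup>2))"
      by (auto simp: indicator_def power2_eq_square)
    then show "indicator ?S y * (far_field_kernel (k + \<tau>) x y * of_real (\<sigma> y)) *
        cnj (indicator ?S y * (far_field_kernel k x y * of_real (\<sigma> y))) =
        of_real (1 / (8 * pi * sqrt (k * (k + \<tau>)))) *
        (indicator ?S y *\<^sub>R (of_real ((\<sigma> y)\<^sup>2) * cnj (fourier_basis a l y)))"
      unfolding kernel by (simp add: mult_ac)
  qed
  also have "\<dots> = of_real (1 / (8 * pi * sqrt (k * (k + \<tau>)))) *
      (LINT y:?S|lebesgue. of_real ((\<sigma> y)\<^sup>2) * cnj (fourier_basis a l y))"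
    unfolding set_lebesgue_integral_def by (rule integral_mult_right_zero)
  also have "\<dots> = of_real (a\<^sup>2 / (8 * pi * sqrt (k * (k + \<tau>)))) * fourier_coeff a (\<lambda>x. (\<sigma> x)\<^sup>2) l"
    using \<open>a > 0\<close> by (simp add: fourier_coeff_def)
  finally show ?thesis .
qed

theorem theorem2:
  fixes a :: real
  assumes "a > 0"
  shows "\<exists>\<kappa>>0. \<forall>k0\<in>{0<..<\<kappa>}. \<forall>d\<in>sphere (0 :: real \<times> real) 1. \<forall>l :: int \<times> int.
    \<forall>(M :: 'w measure) W g \<sigma> (M' :: 'v measure) W' g' \<sigma>'.
      admissible_source a M W g \<sigma> \<longrightarrow> admissible_source a M' W' g' \<sigma>' \<longrightarrow>
      (let \<tau> = wavenumber_shift a l; x = observation_direction d l in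
        covariance M (far_field a M W g \<sigma> x (k0 + \<tau>)) (far_field a M W g \<sigma> x k0) =
        covariance M' (far_field a M' W' g' \<sigma>' x (k0 + \<tau>)) (far_field a M' W' g' \<sigma>' x k0)) \<longrightarrow>
      fourier_coeff a (\<lambda>x. (\<sigma> x)\<^sup>2) l = fourier_coeff a (\<lambda>x. (\<sigma>' x)\<^sup>2) l"
\<comment> \<open>The covariance formula holds at each positive wavenumber, so the threshold 1 is an
  arbitrary choice.\<close>
proof (intro exI[of _ 1] conjI ballI allI impI)
  fix k0 :: real and d l and M :: "'w measure" and W g \<sigma> and M' :: "'v measure" and W' g' \<sigma>'
  assume "k0 \<in> {0<..<1}"
    and adm: "admissible_source a M W g \<sigma>" "admissible_source a M' W' g' \<sigma>'"
    and eq: "let \<tau> = wavenumber_shift a l; x = observation_direction d l in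
        covariance M (far_field a M W g \<sigma> x (k0 + \<tau>)) (far_field a M W g \<sigma> x k0) =
        covariance M' (far_field a M' W' g' \<sigma>' x (k0 + \<tau>)) (far_field a M' W' g' \<sigma>' x k0)"
  then have k0: "k0 > 0" by simp
  have "wavenumber_shift a l \<ge> 0"
    using \<open>a > 0\<close> by (simp add: wavenumber_shift_def)
  \<comment> \<open>The factor depends only on \<open>a\<close>, \<open>k0\<close> and
    \<open>l\<close>, so it is common to both sources and cancels.\<close>
  then have "a\<^sup>2 / (8 * pi * sqrt (k0 * (k0 + wavenumber_shift a l))) \<noteq> 0"
    using \<open>a > 0\<close> k0 by simp
  then show "fourier_coeff a (\<lambda>x. (\<sigma> x)\<^sup>2) l = fourier_coeff a (\<lambda>x. (\<sigma>' x)\<^sup>2) l"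
    using eq unfolding Let_def far_field_covariance[OF \<open>a > 0\<close> k0 adm(1)]
      far_field_covariance[OF \<open>a > 0\<close> k0 adm(2)] by (auto simp only: mult_cancel_left of_real_eq_0_iff)
qed simp

end
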